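(* Let $H$ be a graph without isolated vertices which is not a star. Then, for any integer $t\geq e(H)$, $\operatorname{sat}_t(n,\mathfrak{R}(H))=O(n\log n)$ as $n\to\infty$.
   Context: A $t$-edge-coloured graph is a graph $G$ with a function $c:E(G)\to\{1,\dots,t\}$ (not necessarily proper). A copy of $H$ in a coloured graph is rainbow if all its edges receive distinct colours; $\mathfrak{R}(H)$ denotes the family of rainbow copies of $H$. A $t$-edge-coloured graph $(G,c)$ is $\mathfrak{R}(H)$-saturated if it contains no rainbow copy of $H$, but adding any non-edge of $G$ in any colour from $\{1,\dots,t\}$ creates a rainbow copy of $H$. $\operatorname{sat}_t(n,\mathfrak{R}(H))$ is the minimum number of edges of an $\mathfrak{R}(H)$-saturated $t$-edge-coloured graph on $n$ vertices. $e(H)$ is the number of edges of $H$. A star is a graph $K_{1,k}$. Logarithms are base 2. *)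

theory Defs
  imports "HOL-Library.Landau_Symbols" "HOL-Library.FuncSet"
begin

record 'v sgraph =
  verts :: "'v set"
  edges :: "'v set set"

definition simple_graph :: "'v sgraph \<Rightarrow> bool" where
  "simple_graph G \<longleftrightarrow>
     finite (verts G) \<and> edges G \<subseteq> {{u, v} | u v. u \<in> verts G \<and> v \<in> verts G \<and> u \<noteq> v}"

definition subgraph :: "'v sgraph \<Rightarrow> 'v sgraph \<Rightarrow> bool" where
  "subgraph F G \<longleftrightarrow> simple_graph F \<and> verts F \<subseteq> verts G \<and> edges F \<subseteq> edges G"

definition isomorphic :: "'v sgraph \<Rightarrow> 'w sgraph \<Rightarrow> bool" where
  "isomorphic G H \<longleftrightarrow>
     (\<exists>f. bij_betw f (verts G) (verts H) \<and> (\<lambda>e. f ` e) ` edges G = edges H)"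

definition isolated_vertex :: "'v sgraph \<Rightarrow> 'v \<Rightarrow> bool" where
  "isolated_vertex G v \<longleftrightarrow> v \<in> verts G \<and> (\<forall>e \<in> edges G. v \<notin> e)"

text \<open>The graph $K_{1,k}$ with centre 0 and leaves $1, \dots, k$.\<close>

definition star_graph :: "nat \<Rightarrow> nat sgraph" where
  "star_graph k = \<lparr>verts = {0..k}, edges = {{0, i} | i. i \<in> {1..k}}\<rparr>"

definition is_star :: "'v sgraph \<Rightarrow> bool" where
  "is_star H \<longleftrightarrow> (\<exists>k. isomorphic H (star_graph k))"

definition coloured_graph :: "nat \<Rightarrow> 'v sgraph \<Rightarrow> ('v set \<Rightarrow> nat) \<Rightarrow> bool" where
  "coloured_graph t G c \<longleftrightarrow> simple_graph G \<and> c \<in> edges G \<rightarrow> {1..t}"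

text \<open>Copies are subgraphs, not necessarily induced.\<close>

definition has_rainbow_copy :: "'w sgraph \<Rightarrow> 'v sgraph \<Rightarrow> ('v set \<Rightarrow> nat) \<Rightarrow> bool" where
  "has_rainbow_copy H G c \<longleftrightarrow>
     (\<exists>F. subgraph F G \<and> isomorphic H F \<and> inj_on c (edges F))"

definition add_edge :: "'v set \<Rightarrow> 'v sgraph \<Rightarrow> 'v sgraph" where
  "add_edge e G = G\<lparr>edges := insert e (edges G)\<rparr>"

definition rainbow_saturated :: "nat \<Rightarrow> 'w sgraph \<Rightarrow> 'v sgraph \<Rightarrow> ('v set \<Rightarrow> nat) \<Rightarrow> bool" where
  "rainbow_saturated t H G c \<longleftrightarrow>
     coloured_graph t G c \<and>
     \<not> has_rainbow_copy H G c \<and>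
     (\<forall>u \<in> verts G. \<forall>v \<in> verts G. u \<noteq> v \<longrightarrow> {u, v} \<notin> edges G \<longrightarrow>
        (\<forall>i \<in> {1..t}. has_rainbow_copy H (add_edge {u, v} G) (c({u, v} := i))))"

text \<open>
  The infimum below is an attained minimum as soon as \<open>H\<close> has an edge; see \<open>rainbow_sat_attained\<close>.
  For edgeless \<open>H\<close> without isolated vertices, which is only the null graph, there are no saturated
  graphs and the value is the convention \<open>Inf {} = 0\<close>.
\<close>

definition rainbow_sat :: "nat \<Rightarrow> nat \<Rightarrow> 'w sgraph \<Rightarrow> nat" where
  "rainbow_sat t n H =
     Inf {card (edges G) | (G :: nat sgraph) c. card (verts G) = n \<and> rainbow_saturated t H G c}"

lemma rainbow_saturated_exists:
  fixes H :: "'w sgraph"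
  assumes "edges H \<noteq> {}"
  shows "\<exists>(G :: nat sgraph) c. card (verts G) = n \<and> rainbow_saturated t H G c"
proof -
  define P :: "nat sgraph \<times> (nat set \<Rightarrow> nat) \<Rightarrow> bool" where
    "P = (\<lambda>(G, c). verts G = {..<n} \<and> coloured_graph t G c \<and> \<not> has_rainbow_copy H G c)"
  have "P (\<lparr>verts = {..<n}, edges = {}\<rparr>, \<lambda>_. 1)"
    using assms
    by (auto simp: P_def coloured_graph_def simple_graph_def has_rainbow_copy_def
        subgraph_def isomorphic_def)
  moreover have sub: "edges G \<subseteq> Pow {..<n}" if "P (G, c)" for G c
    using that by (auto simp: P_def coloured_graph_def simple_graph_def)
  have "\<forall>x. P x \<longrightarrow> card (edges (fst x)) < Suc (card (Pow {..<n}))"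
    using sub by (auto simp: less_Suc_eq_le simp del: card_Pow intro!: card_mono)
  ultimately obtain x where x: "P x"
    and max: "\<And>y. P y \<Longrightarrow> card (edges (fst y)) \<le> card (edges (fst x))"
    using ex_has_greatest_nat[of P _ "\<lambda>x. card (edges (fst x))"] by blast
  obtain G c where Gc: "x = (G, c)" by force
  have fin: "finite (edges G)"
    using sub x Gc by (metis finite_Pow_iff finite_lessThan finite_subset)
  have "has_rainbow_copy H (add_edge {u, v} G) (c({u, v} := i))"
    if "u \<in> verts G" "v \<in> verts G" "u \<noteq> v" "{u, v} \<notin> edges G" "i \<in> {1..t}" for u v i
  proof (rule ccontr)
    assume "\<not> ?thesis"
    then have "P (add_edge {u, v} G, c({u, v} := i))"
      using x that unfolding Gc
      by (auto simp: P_def coloured_graph_def simple_graph_def add_edge_def Pi_iff)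
    from max[OF this] show False
      using fin that by (simp add: Gc add_edge_def)
  qed
  then have "rainbow_saturated t H G c" "card (verts G) = n"
    using x by (auto simp: P_def Gc rainbow_saturated_def)
  then show ?thesis by blast
qed

lemma rainbow_sat_attained:
  fixes H :: "'w sgraph"
  assumes "edges H \<noteq> {}"
  obtains G :: "nat sgraph" and c
  where "card (verts G) = n" "rainbow_saturated t H G c" "rainbow_sat t n H = card (edges G)"
proof -
  let ?S = "{card (edges G) | (G :: nat sgraph) c. card (verts G) = n \<and> rainbow_saturated t H G c}"
  have "?S \<noteq> {}" using rainbow_saturated_exists[OF assms, of n t] by blast
  then have "Inf ?S \<in> ?S" by (rule Inf_nat_def1)
  then show thesis using that unfolding rainbow_sat_def by blast
qed

end

theory Submission
  imports Defs
begin

text \<open>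
  It suffices to find a coloured graph without a rainbow copy of \<open>H\<close> and a vertex set \<open>A\<close> with
  \<open>O(log n)\<close> elements whose complement \<open>B\<close> is independent and such that every new edge inside \<open>B\<close>, in
  any colour, creates a copy: in a saturated extension all edges then meet \<open>A\<close>.

  If \<open>H\<close> has an edge \<open>xy\<close> with both degrees at least 2, choose one with maximal degree sum. Let \<open>A\<close>
  consist of gadgets, i.e. copies of \<open>H - {x, y}\<close>; each vertex of \<open>B\<close> is joined to each gadget either as
  \<open>x\<close> or as \<open>y\<close>, according to a binary digit of its number, so that any two vertices of \<open>B\<close> play
  different roles in some gadget. All gadgets carry the same rainbow colouring of \<open>H - xy\<close>, except that
  the gadgets of kind \<open>i\<close> use the one remaining colour in place of \<open>i\<close>. This rigidity leaves only one
  possible shape for a rainbow copy of \<open>H\<close>: it arises from \<open>H\<close> by contracting \<open>xy\<close> and splitting a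
  neighbour \<open>w\<close> of \<open>x\<close> or \<open>y\<close>. Comparing the numbers of vertices of degree \<open>d(x) + d(y) - 1\<close>, this forces
  \<open>d(w) = d(x) + d(y) - 1\<close>, against the choice of \<open>xy\<close>.

  Otherwise \<open>H\<close> is a star forest and a set \<open>A\<close> of bounded size suffices. Without isolated edges, \<open>A\<close> has
  one vertex fewer than \<open>H\<close> has edges, and each vertex of \<open>A\<close> sends a single colour to \<open>B\<close>; a rainbow copy
  of \<open>H\<close> would need one vertex of \<open>A\<close> per edge.
\<close>

section \<open>Rainbow copies as vertex maps\<close>

definition rainbow_embedding ::
    "('w \<Rightarrow> 'v) \<Rightarrow> 'w sgraph \<Rightarrow> 'v sgraph \<Rightarrow> ('v set \<Rightarrow> nat) \<Rightarrow> bool" where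
  "rainbow_embedding f H G c \<longleftrightarrow>
     inj_on f (verts H) \<and> f ` verts H \<subseteq> verts G \<and>
     (\<forall>e \<in> edges H. f ` e \<in> edges G) \<and> inj_on (\<lambda>e. c (f ` e)) (edges H)"

lemma simple_graph_edge_subset: "simple_graph G \<Longrightarrow> e \<in> edges G \<Longrightarrow> e \<subseteq> verts G"
  by (auto simp: simple_graph_def)

lemma simple_graph_edgeE:
  assumes "simple_graph G" "e \<in> edges G"
  obtains u v where "e = {u, v}" "u \<noteq> v" "u \<in> verts G" "v \<in> verts G"
  using assms by (auto simp: simple_graph_def)

lemma simple_graph_edge_other:
  assumes "simple_graph G" "e \<in> edges G" "u \<in> e"
  obtains v where "e = {u, v}" "u \<noteq> v" "u \<in> verts G" "v \<in> verts G"
proof -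
  obtain a b where "e = {a, b}" "a \<noteq> b" "a \<in> verts G" "b \<in> verts G"
    using simple_graph_edgeE[OF assms(1,2)] .
  then show thesis using that[of a] that[of b] assms(3) by (auto simp: insert_commute)
qed

lemma simple_graph_card_edge: "simple_graph G \<Longrightarrow> e \<in> edges G \<Longrightarrow> card e = 2"
  by (auto elim!: simple_graph_edgeE)

lemma simple_graph_finite_edges: "simple_graph G \<Longrightarrow> finite (edges G)"
  by (rule finite_subset[of _ "Pow (verts G)"]) (auto simp: simple_graph_def)

text \<open>Edges are sets of vertices, so an injective vertex map is also injective on edges;
  distinct colours on the copy then amount to distinct colours indexed by the edges of
  \<open>H\<close>.\<close>

lemma has_rainbow_copy_iff:
  assumes H: "simple_graph H"
  shows "has_rainbow_copy H G c \<longleftrightarrow> (\<exists>f. rainbow_embedding f H G c)"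
proof
  assume "has_rainbow_copy H G c"
  then obtain F f where F: "subgraph F G" "inj_on c (edges F)"
    and f: "bij_betw f (verts H) (verts F)" "(\<lambda>e. f ` e) ` edges H = edges F"
    unfolding has_rainbow_copy_def isomorphic_def by blast
  have inj: "inj_on ((`) f) (edges H)"
    by (rule inj_on_subset[OF inj_on_image_Pow[OF bij_betw_imp_inj_on[OF f(1)]]])
      (use simple_graph_edge_subset[OF H] in blast)
  have "inj_on (c \<circ> (`) f) (edges H)"
    using inj F(2) f(2) by (intro comp_inj_on) auto
  then have "rainbow_embedding f H G c"
    using F f unfolding rainbow_embedding_def subgraph_def bij_betw_def comp_def by blast
  then show "\<exists>f. rainbow_embedding f H G c" by blast
next
  assume "\<exists>f. rainbow_embedding f H G c"
  then obtain f where f: "rainbow_embedding f H G c" ..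
  define F where "F = \<lparr>verts = f ` verts H, edges = (\<lambda>e. f ` e) ` edges H\<rparr>"
  have inj: "inj_on f (verts H)"
    using f by (auto simp: rainbow_embedding_def)
  have "simple_graph F"
    unfolding simple_graph_def
  proof
    show "finite (verts F)" using H by (simp add: F_def simple_graph_def)
    show "edges F \<subseteq> {{u, v} | u v. u \<in> verts F \<and> v \<in> verts F \<and> u \<noteq> v}"
    proof
      fix e assume "e \<in> edges F"
      then obtain e' where e': "e' \<in> edges H" "e = f ` e'" by (auto simp: F_def)
      obtain u v where "e' = {u, v}" "u \<noteq> v" "u \<in> verts H" "v \<in> verts H"
        using simple_graph_edgeE[OF H e'(1)] .
      then have "e = {f u, f v}" "f u \<in> verts F" "f v \<in> verts F" "f u \<noteq> f v"
        using inj e'(2) by (auto simp: F_def inj_on_def)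
      then show "e \<in> {{u, v} | u v. u \<in> verts F \<and> v \<in> verts F \<and> u \<noteq> v}" by blast
    qed
  qed
  then have "subgraph F G"
    using f by (auto simp: F_def subgraph_def rainbow_embedding_def)
  moreover have "isomorphic H F"
    unfolding isomorphic_def using inj by (intro exI[of _ f]) (simp add: F_def bij_betw_def)
  moreover have "inj_on c (edges F)"
    using f by (auto simp: F_def rainbow_embedding_def inj_on_def)
  ultimately show "has_rainbow_copy H G c"
    unfolding has_rainbow_copy_def by blast
qed

text \<open>With \<open>g = id\<close> this is monotonicity under passing to a supergraph; with a
  relabelling it moves copies between vertex types.\<close>

lemma has_rainbow_copy_map:
  assumes "simple_graph H" "has_rainbow_copy H G c"
    and "inj_on g (verts G)" "g ` verts G \<subseteq> verts G'"
    and "\<And>e. e \<in> edges G \<Longrightarrow> g ` e \<in> edges G' \<and> c' (g ` e) = c e"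
  shows "has_rainbow_copy H G' c'"
proof -
  obtain f where f: "rainbow_embedding f H G c"
    using assms(1,2) by (auto simp: has_rainbow_copy_iff)
  have "inj_on (g \<circ> f) (verts H)"
    using f assms(3) unfolding rainbow_embedding_def by (intro comp_inj_on) (auto intro: inj_on_subset)
  moreover have "inj_on (\<lambda>e. c' ((g \<circ> f) ` e)) (edges H)"
    using f assms(5) by (simp add: rainbow_embedding_def inj_on_def image_comp[symmetric] del: o_apply)
  ultimately have "rainbow_embedding (g \<circ> f) H G' c'"
    using f assms(4,5) unfolding rainbow_embedding_def
    by (auto simp: image_comp[symmetric] simp del: o_apply) (auto simp: image_subset_iff)
  then show ?thesis using assms(1) by (auto simp: has_rainbow_copy_iff)
qed

section \<open>Saturated extensions and the bound on their edges\<close>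

lemma saturated_extension:
  fixes G :: "'v sgraph"
  assumes "coloured_graph t G c" "\<not> has_rainbow_copy H G c"
  obtains G' c' where "verts G' = verts G" "edges G \<subseteq> edges G'" "\<And>e. e \<in> edges G \<Longrightarrow> c' e = c e"
    "rainbow_saturated t H G' c'"
proof -
  define P :: "'v sgraph \<times> ('v set \<Rightarrow> nat) \<Rightarrow> bool" where
    "P = (\<lambda>(G', c'). verts G' = verts G \<and> edges G \<subseteq> edges G' \<and> (\<forall>e \<in> edges G. c' e = c e) \<and>
            coloured_graph t G' c' \<and> \<not> has_rainbow_copy H G' c')"
  have finV: "finite (verts G)"
    using assms(1) by (simp add: coloured_graph_def simple_graph_def)
  have "P (G, c)"
    using assms by (simp add: P_def)
  moreover have sub: "edges G' \<subseteq> Pow (verts G)" if "P (G', c')" for G' c'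
    using that by (auto simp: P_def coloured_graph_def simple_graph_def)
  have "\<forall>x. P x \<longrightarrow> card (edges (fst x)) < Suc (card (Pow (verts G)))"
    using sub finV by (auto simp: less_Suc_eq_le simp del: card_Pow intro!: card_mono)
  \<comment> \<open>Among the extensions without a rainbow copy, one with the most edges is taken:
    an edge that could be added without creating a copy would contradict this choice.\<close>
  ultimately obtain x where x: "P x"
    and max: "\<And>y. P y \<Longrightarrow> card (edges (fst y)) \<le> card (edges (fst x))"
    using ex_has_greatest_nat[of P _ "\<lambda>x. card (edges (fst x))"] by blast
  obtain G' c' where Gc: "x = (G', c')" by force
  have fin: "finite (edges G')"
    using sub x Gc finV by (metis finite_Pow_iff finite_subset)
  have "has_rainbow_copy H (add_edge {u, v} G') (c'({u, v} := i))"
    if "u \<in> verts G'" "v \<in> verts G'" "u \<noteq> v" "{u, v} \<notin> edges G'" "i \<in> {1..t}" for u v i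
  proof (rule ccontr)
    assume "\<not> ?thesis"
    then have "P (add_edge {u, v} G', c'({u, v} := i))"
      using x that unfolding Gc
      by (auto simp: P_def coloured_graph_def simple_graph_def add_edge_def Pi_iff)
    from max[OF this] show False
      using fin that by (simp add: Gc add_edge_def)
  qed
  then have "rainbow_saturated t H G' c'"
    using x by (auto simp: P_def Gc rainbow_saturated_def)
  with x show thesis unfolding P_def Gc by (intro that[of G' c']) simp_all
qed

text \<open>\<open>rainbow_sat\<close> ranges over graphs on natural numbers, whereas the
  constructions live on sum types; an injective relabelling bridges the two.\<close>

lemma saturated_transfer:
  fixes G :: "'v sgraph" and g :: "'v \<Rightarrow> 'w"
  assumes H: "simple_graph H" and sat: "rainbow_saturated t H G c" and g: "inj_on g (verts G)"
  obtains G' c' where "card (verts G') = card (verts G)" "card (edges G') = card (edges G)"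
    "rainbow_saturated t H (G' :: 'w sgraph) c'"
proof -
  define k where "k = the_inv_into (verts G) g"
  define G' where "G' = \<lparr>verts = g ` verts G, edges = (`) g ` edges G\<rparr>"
  define c' where "c' = (\<lambda>e. c (k ` e))"
  have sG: "simple_graph G" and cG: "c \<in> edges G \<rightarrow> {1..t}"
    using sat by (auto simp: rainbow_saturated_def coloured_graph_def)
  have kg: "k (g v) = v" if "v \<in> verts G" for v
    using that g by (simp add: k_def the_inv_into_f_f)
  have kgi: "k ` g ` e = e" if "e \<subseteq> verts G" for e
    using that kg by (force simp: image_comp)
  have esub: "e \<subseteq> verts G" if "e \<in> edges G" for e
    using that sG simple_graph_edge_subset by blast
  have injE: "inj_on ((`) g) (Pow (verts G))"
    using g by (rule inj_on_image_Pow)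
  have sG': "simple_graph G'"
    unfolding simple_graph_def
  proof
    show "finite (verts G')" using sG by (simp add: G'_def simple_graph_def)
    show "edges G' \<subseteq> {{u, v} | u v. u \<in> verts G' \<and> v \<in> verts G' \<and> u \<noteq> v}"
    proof
      fix e assume "e \<in> edges G'"
      then obtain e' where e': "e' \<in> edges G" "e = g ` e'" by (auto simp: G'_def)
      obtain u v where "e' = {u, v}" "u \<noteq> v" "u \<in> verts G" "v \<in> verts G"
        using simple_graph_edgeE[OF sG e'(1)] .
      then have "e = {g u, g v}" "g u \<in> verts G'" "g v \<in> verts G'" "g u \<noteq> g v"
        using g e'(2) by (auto simp: G'_def inj_on_def)
      then show "e \<in> {{u, v} | u v. u \<in> verts G' \<and> v \<in> verts G' \<and> u \<noteq> v}" by blast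
    qed
  qed
  have col: "coloured_graph t G' c'"
    using sG' cG esub kgi by (auto simp: coloured_graph_def G'_def c'_def Pi_iff)
  have free: "\<not> has_rainbow_copy H G' c'"
  proof
    assume "has_rainbow_copy H G' c'"
    then have "has_rainbow_copy H G c"
    proof (rule has_rainbow_copy_map[OF H, where g = k])
      show "inj_on k (verts G')" using kg by (auto simp: G'_def inj_on_def)
      show "k ` verts G' \<subseteq> verts G" using kg by (auto simp: G'_def)
      show "k ` e \<in> edges G \<and> c (k ` e) = c' e" if "e \<in> edges G'" for e
        using that kgi esub by (auto simp: G'_def c'_def)
    qed
    then show False using sat by (simp add: rainbow_saturated_def)
  qed
  have "has_rainbow_copy H (add_edge {u, v} G') (c'({u, v} := i))"
    if uv: "u \<in> verts G'" "v \<in> verts G'" "u \<noteq> v" "{u, v} \<notin> edges G'" "i \<in> {1..t}" for u v i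
  proof -
    obtain a b where ab: "a \<in> verts G" "b \<in> verts G" "u = g a" "v = g b"
      using uv by (auto simp: G'_def)
    have gab: "{u, v} = g ` {a, b}" using ab by simp
    have "g ` {a, b} \<notin> (`) g ` edges G"
      using uv(4) unfolding gab G'_def by simp
    then have ab': "{a, b} \<notin> edges G" "a \<noteq> b"
      using uv(3) ab by blast+
    then have "has_rainbow_copy H (add_edge {a, b} G) (c({a, b} := i))"
      using sat ab uv by (simp add: rainbow_saturated_def)
    then show ?thesis
    proof (rule has_rainbow_copy_map[OF H, where g = g])
      show "inj_on g (verts (add_edge {a, b} G))" using g by (simp add: add_edge_def)
      show "g ` verts (add_edge {a, b} G) \<subseteq> verts (add_edge {u, v} G')"
        by (simp add: add_edge_def G'_def)
      show "g ` e \<in> edges (add_edge {u, v} G') \<and> (c'({u, v} := i)) (g ` e) = (c({a, b} := i)) e"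
        if e: "e \<in> edges (add_edge {a, b} G)" for e
      proof (cases "e = {a, b}")
        case True
        then show ?thesis using gab by (simp add: add_edge_def)
      next
        case False
        then have eG: "e \<in> edges G" using e by (simp add: add_edge_def)
        then have "g ` e \<noteq> g ` {a, b}"
          using inj_onD[OF injE, of e "{a, b}"] esub[OF eG] ab False by auto
        then show ?thesis
          using eG False kgi[OF esub[OF eG]] unfolding gab by (auto simp: add_edge_def G'_def c'_def)
      qed
    qed
  qed
  then have "rainbow_saturated t H G' c'"
    using col free by (simp add: rainbow_saturated_def)
  moreover have "card (verts G') = card (verts G)"
    using g by (simp add: G'_def card_image)
  moreover have "card (edges G') = card (edges G)"
    using injE esub by (auto simp: G'_def intro!: card_image inj_on_subset[OF injE])
  ultimately show thesis using that by blast
qed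

text \<open>Saturating may add edges in any colours, but an edge avoiding \<open>A\<close> would
  complete a copy by \<open>addable\<close>, whatever its colour. So every edge meets
  \<open>A\<close>, and the edges are counted by pairs from
  \<open>A \<times> verts G\<close>.\<close>

lemma rainbow_sat_le:
  fixes G :: "'v sgraph"
  assumes H: "simple_graph H" and G: "coloured_graph t G c" "\<not> has_rainbow_copy H G c"
    and A: "A \<subseteq> verts G"
    and indep: "\<And>u v. u \<in> verts G - A \<Longrightarrow> v \<in> verts G - A \<Longrightarrow> {u, v} \<notin> edges G"
    and addable: "\<And>u v i. u \<in> verts G - A \<Longrightarrow> v \<in> verts G - A \<Longrightarrow> u \<noteq> v \<Longrightarrow> i \<in> {1..t} \<Longrightarrow>
        has_rainbow_copy H (add_edge {u, v} G) (c({u, v} := i))"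
  shows "rainbow_sat t (card (verts G)) H \<le> card A * card (verts G)"
proof -
  obtain G' c' where G': "verts G' = verts G" "edges G \<subseteq> edges G'" "\<And>e. e \<in> edges G \<Longrightarrow> c' e = c e"
    "rainbow_saturated t H G' c'"
    using saturated_extension[OF G] by blast
  have sG': "simple_graph G'" and c': "c' \<in> edges G' \<rightarrow> {1..t}" and free: "\<not> has_rainbow_copy H G' c'"
    using G'(4) by (auto simp: rainbow_saturated_def coloured_graph_def)
  have fin: "finite (verts G)" using sG' G'(1) by (simp add: simple_graph_def)
  have "edges G' \<subseteq> (\<lambda>(a, b). {a, b}) ` (A \<times> verts G)"
  proof
    fix e assume e: "e \<in> edges G'"
    obtain u v where uv: "e = {u, v}" "u \<noteq> v" "u \<in> verts G" "v \<in> verts G"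
      using simple_graph_edgeE[OF sG' e] G'(1) by metis
    have "u \<in> A \<or> v \<in> A"
    proof (rule ccontr)
      assume "\<not> ?thesis"
      then have uv': "u \<in> verts G - A" "v \<in> verts G - A" using uv by auto
      have "c' e \<in> {1..t}" using c' e by blast
      then have "has_rainbow_copy H (add_edge {u, v} G) (c({u, v} := c' e))"
        using addable uv' uv by blast
      then have "has_rainbow_copy H G' c'"
        by (rule has_rainbow_copy_map[OF H, where g = id])
          (use G' e uv in \<open>auto simp: add_edge_def\<close>)
      then show False using free by simp
    qed
    then show "e \<in> (\<lambda>(a, b). {a, b}) ` (A \<times> verts G)"
      using uv by (auto simp: insert_commute)
  qed
  then have "card (edges G') \<le> card ((\<lambda>(a, b). {a, b}) ` (A \<times> verts G))"
    using fin A by (intro card_mono) (auto intro: finite_subset)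
  also have "\<dots> \<le> card (A \<times> verts G)"
    using fin A by (intro card_image_le) (auto intro: finite_subset)
  finally have card: "card (edges G') \<le> card A * card (verts G)"
    by (simp add: card_cartesian_product)
  obtain g :: "'v \<Rightarrow> nat" where "inj_on g (verts G')"
    using fin G'(1) finite_imp_inj_to_nat_seg by metis
  then obtain G'' c'' where "card (verts G'') = card (verts G)" "card (edges G'') = card (edges G')"
    "rainbow_saturated t H (G'' :: nat sgraph) c''"
    using saturated_transfer[OF H G'(4)] G'(1) by metis
  then have "rainbow_sat t (card (verts G)) H \<le> card (edges G')"
    unfolding rainbow_sat_def by (intro cInf_lower) force+
  then show ?thesis using card by simp
qed

section \<open>Degrees, numberings and copies completed by a new edge\<close>

definition degree :: "'v sgraph \<Rightarrow> 'v \<Rightarrow> nat" where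
  "degree G v = card {e \<in> edges G. v \<in> e}"

text \<open>Common last step of all constructions: \<open>h\<close> places \<open>{x, y}\<close> on
  the new edge, and \<open>k\<close> records the colours of the other images, which only have to be
  distinct and avoid \<open>i\<close>.\<close>

lemma rainbow_copy_add_edge:
  assumes H: "simple_graph H" and xy: "{x, y} \<in> edges H"
    and h: "inj_on h (verts H)" "h ` verts H \<subseteq> verts G"
    and new: "{h x, h y} \<notin> edges G"
    and old: "\<And>f. f \<in> edges H - {{x, y}} \<Longrightarrow> h ` f \<in> edges G \<and> c (h ` f) = k f \<and> k f \<noteq> i"
    and k: "inj_on k (edges H - {{x, y}})"
  shows "has_rainbow_copy H (add_edge {h x, h y} G) (c({h x, h y} := i))"
proof -
  let ?c = "c({h x, h y} := i)"
  have c_xy: "?c (h ` {x, y}) = i" by simp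
  have c: "?c (h ` f) = k f" "k f \<noteq> i" if "f \<in> edges H - {{x, y}}" for f
    using old[OF that] new by auto
  have "inj_on (\<lambda>f. ?c (h ` f)) (edges H)"
  proof (rule inj_onI)
    fix f f' assume "f \<in> edges H" "f' \<in> edges H" "?c (h ` f) = ?c (h ` f')"
    then show "f = f'"
      using c[of f] c[of f'] c_xy inj_onD[OF k, of f f']
      by (cases "f = {x, y}"; cases "f' = {x, y}") (simp_all del: fun_upd_apply image_insert)
  qed
  moreover have "h ` f \<in> edges (add_edge {h x, h y} G)" if "f \<in> edges H" for f
    using old[of f] that by (cases "f = {x, y}") (auto simp: add_edge_def)
  ultimately have "rainbow_embedding h H (add_edge {h x, h y} G) ?c"
    using h by (auto simp: rainbow_embedding_def add_edge_def)
  then show ?thesis using has_rainbow_copy_iff[OF H] by blast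
qed

lemma degree_1_unique:
  assumes "degree H v = 1" "f \<in> edges H" "f' \<in> edges H" "v \<in> f" "v \<in> f'"
  shows "f = f'"
proof -
  obtain g where "{f \<in> edges H. v \<in> f} = {g}"
    using assms(1) unfolding degree_def by (rule card_1_singletonE)
  moreover have "f \<in> {f \<in> edges H. v \<in> f}" "f' \<in> {f \<in> edges H. v \<in> f}"
    using assms by simp_all
  ultimately show ?thesis by simp
qed

lemma degree_pos:
  assumes "simple_graph H" "f \<in> edges H" "v \<in> f"
  shows "degree H v \<ge> 1"
proof -
  have "card {f \<in> edges H. v \<in> f} > 0"
    using assms simple_graph_finite_edges[of H] by (auto simp: card_gt_0_iff)
  then show ?thesis by (simp add: degree_def)
qed

text \<open>The designated element receives the last number, so the other edges or leaves use
  exactly the smaller ones and the last remains as a spare colour.\<close>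

lemma ex_bij_last:
  assumes "finite S" "s \<in> S"
  obtains \<phi> :: "'b \<Rightarrow> nat" where "bij_betw \<phi> S {1..card S}" "\<phi> s = card S"
proof -
  obtain \<psi>' where "bij_betw \<psi>' {1..card (S - {s})} (S - {s})"
    using ex_bij_betw_nat_finite_1[of "S - {s}"] assms(1) by auto
  from bij_betw_inv_into[OF this]
  obtain \<psi> where \<psi>: "bij_betw \<psi> (S - {s}) {1..card (S - {s})}" ..
  have card: "card S = Suc (card (S - {s}))"
    by (rule card.remove[OF assms])
  have "bij_betw (\<psi>(s := card S)) (S - {s} \<union> {s}) ({1..card (S - {s})} \<union> {card S})"
  proof (rule bij_betw_combine)
    show "bij_betw (\<psi>(s := card S)) (S - {s}) {1..card (S - {s})}"
      by (rule bij_betw_cong[THEN iffD2, OF _ \<psi>]) simp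
  qed (use card in auto)
  moreover have "S - {s} \<union> {s} = S" "{1..card (S - {s})} \<union> {card S} = {1..card S}"
    using assms card by auto
  ultimately show thesis using that[of "\<psi>(s := card S)"] by simp
qed

section \<open>A nonpendant edge\<close>

text \<open>Two numbers below \<open>2 ^ L\<close> thus differ in a digit that indexes one of the
  gadgets.\<close>

lemma bit_lt_exponent: "bit m j \<Longrightarrow> m < 2 ^ L \<Longrightarrow> j < L" for m j L :: nat
proof (rule ccontr)
  assume m: "bit m j" "m < 2 ^ L" "\<not> j < L"
  then have "(2::nat) ^ L \<le> 2 ^ j" by (intro power_increasing) auto
  then have "m div 2 ^ j = 0" using m(2) by (meson div_less less_le_trans)
  then show False using m(1) by (simp add: bit_iff_odd)
qed

text \<open>The numbers below \<open>N\<close> become the vertices outside \<open>A\<close>, and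
  \<open>N_le\<close> makes \<open>L\<close> binary digits enough to tell them apart. The colour of
  \<open>{x, y}\<close> does not occur on the other edges of \<open>H\<close> and serves as the
  replacement colour. \<open>maximal\<close> gives the final contradiction in
  \<open>G_free\<close>.\<close>

locale gadget_graph =
  fixes H :: "'a sgraph" and x y :: 'a and \<phi> :: "'a set \<Rightarrow> nat" and L N :: nat
  assumes simple: "simple_graph H"
    and no_isolated: "\<nexists>v. isolated_vertex H v"
    and xy: "{x, y} \<in> edges H" "x \<noteq> y"
    and deg_x: "degree H x \<ge> 2" and deg_y: "degree H y \<ge> 2"
    and maximal: "\<And>u v. {u, v} \<in> edges H \<Longrightarrow> degree H u \<ge> 2 \<Longrightarrow> degree H v \<ge> 2 \<Longrightarrow>
          degree H u + degree H v \<le> degree H x + degree H y"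
    and bij_\<phi>: "bij_betw \<phi> (edges H) {1..card (edges H)}"
    and \<phi>_xy: "\<phi> {x, y} = card (edges H)"
    and N_le: "N \<le> 2 ^ L"
begin

abbreviation e where "e \<equiv> card (edges H)"

definition core where "core = verts H - {x, y}"

text \<open>In a pair \<open>(i, j)\<close>, \<open>i\<close> is the omitted colour and
  \<open>j\<close> the binary digit that assigns the roles.\<close>

definition gadgets :: "(nat \<times> nat) set" where "gadgets = {1..e} \<times> {..<L}"

definition A :: "((nat \<times> nat) \<times> 'a + nat) set" where "A = Inl ` (gadgets \<times> core)"

definition role :: "nat \<times> nat \<Rightarrow> nat \<Rightarrow> 'a" where
  "role g m = (if bit m (snd g) then x else y)"

text \<open>Meaningful only on \<open>cell g\<close>, since the gadget to which a core vertex
  belongs is ignored.\<close>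

definition position :: "nat \<times> nat \<Rightarrow> (nat \<times> nat) \<times> 'a + nat \<Rightarrow> 'a" where
  "position g v = (case v of Inl (g', a) \<Rightarrow> a | Inr m \<Rightarrow> role g m)"

definition cell :: "nat \<times> nat \<Rightarrow> ((nat \<times> nat) \<times> 'a + nat) set" where
  "cell g = Inl ` ({g} \<times> core) \<union> Inr ` {..<N}"

text \<open>The condition \<open>card \<epsilon> = 2\<close> excludes sets in which several outside
  vertices share a role: their positions may form an edge of \<open>H\<close> too.\<close>

definition G :: "((nat \<times> nat) \<times> 'a + nat) sgraph" where
  "G = \<lparr>verts = A \<union> Inr ` {..<N},
        edges = {\<epsilon>. card \<epsilon> = 2 \<and>
          (\<exists>g \<in> gadgets. \<epsilon> \<subseteq> cell g \<and> position g ` \<epsilon> \<in> edges H - {{x, y}})}\<rparr>"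

text \<open>Well defined on edges of \<open>G\<close>: one of their positions is a core vertex, and
  a cell has core vertices of a single gadget.\<close>

definition gadget :: "((nat \<times> nat) \<times> 'a + nat) set \<Rightarrow> nat \<times> nat" where
  "gadget \<epsilon> = (THE g. \<exists>a. Inl (g, a) \<in> \<epsilon>)"

text \<open>The gadget \<open>(i, j)\<close> omits colour \<open>i\<close>: it uses the colour of \<open>{x, y}\<close> in its place.\<close>

definition gadget_colour :: "nat \<times> nat \<Rightarrow> 'a set \<Rightarrow> nat" where
  "gadget_colour g f = (if \<phi> f = fst g then e else \<phi> f)"

definition colour :: "((nat \<times> nat) \<times> 'a + nat) set \<Rightarrow> nat" where
  "colour \<epsilon> = gadget_colour (gadget \<epsilon>) (position (gadget \<epsilon>) ` \<epsilon>)"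

lemma position_simps [simp]: "position g (Inl (g', a)) = a" "position g (Inr m) = role g m"
  by (auto simp: position_def)

lemma finite_edges: "finite (edges H)"
  using simple by (rule simple_graph_finite_edges)

lemma xy_verts: "x \<in> verts H" "y \<in> verts H"
  using simple_graph_edge_subset[OF simple xy(1)] by auto

lemma edge_core:
  assumes "f \<in> edges H - {{x, y}}"
  obtains w where "w \<in> f" "w \<in> core"
proof -
  obtain u v where "f = {u, v}" "u \<noteq> v" "u \<in> verts H" "v \<in> verts H"
    using simple_graph_edgeE[OF simple] assms by blast
  then show thesis using that assms by (auto simp: core_def doubleton_eq_iff)
qed

lemma cell_Inl: "v \<in> cell g \<Longrightarrow> position g v \<in> core \<Longrightarrow> v = Inl (g, position g v)"
  by (auto simp: cell_def role_def core_def split: if_splits)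

lemma gadget_eq:
  assumes "\<epsilon> \<subseteq> cell g" "position g ` \<epsilon> \<in> edges H - {{x, y}}"
  shows "gadget \<epsilon> = g" "\<exists>a. Inl (g, a) \<in> \<epsilon>"
proof -
  obtain w where "w \<in> position g ` \<epsilon>" "w \<in> core"
    using edge_core[OF assms(2)] .
  then obtain v where "v \<in> \<epsilon>" "position g v \<in> core" by auto
  then have "Inl (g, position g v) \<in> \<epsilon>" using cell_Inl[of v g] assms(1) by auto
  then show *: "\<exists>a. Inl (g, a) \<in> \<epsilon>" by blast
  have "g' = g" if "Inl (g', a) \<in> \<epsilon>" for g' a
    using that assms(1) by (auto simp: cell_def)
  then show "gadget \<epsilon> = g"
    unfolding gadget_def using * by (intro the_equality) blast+
qed

lemma edge_G:
  assumes "\<epsilon> \<in> edges G"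
  shows "card \<epsilon> = 2" "gadget \<epsilon> \<in> gadgets" "\<epsilon> \<subseteq> cell (gadget \<epsilon>)"
    "position (gadget \<epsilon>) ` \<epsilon> \<in> edges H - {{x, y}}" "\<exists>a. Inl (gadget \<epsilon>, a) \<in> \<epsilon>"
proof -
  obtain g where g: "g \<in> gadgets" "\<epsilon> \<subseteq> cell g" "position g ` \<epsilon> \<in> edges H - {{x, y}}"
    using assms by (auto simp: G_def)
  then have eq: "gadget \<epsilon> = g" and ex: "\<exists>a. Inl (g, a) \<in> \<epsilon>"
    using gadget_eq by blast+
  show "card \<epsilon> = 2" "gadget \<epsilon> \<in> gadgets" "\<epsilon> \<subseteq> cell (gadget \<epsilon>)"
    "position (gadget \<epsilon>) ` \<epsilon> \<in> edges H - {{x, y}}" "\<exists>a. Inl (gadget \<epsilon>, a) \<in> \<epsilon>"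
    using assms g ex unfolding eq by (simp_all add: G_def)
qed

lemma cell_subset: "g \<in> gadgets \<Longrightarrow> cell g \<subseteq> verts G"
  by (auto simp: G_def cell_def A_def)

lemma \<phi>_range: "f \<in> edges H \<Longrightarrow> \<phi> f \<in> {1..e}"
  using bij_\<phi> by (auto simp: bij_betw_def)

lemma \<phi>_eq_iff: "f \<in> edges H \<Longrightarrow> f' \<in> edges H \<Longrightarrow> \<phi> f = \<phi> f' \<longleftrightarrow> f = f'"
  using bij_\<phi> by (auto simp: bij_betw_def inj_on_def)

lemma \<phi>_neq_e: "f \<in> edges H - {{x, y}} \<Longrightarrow> \<phi> f \<noteq> e"
  using \<phi>_eq_iff[OF _ xy(1)] \<phi>_xy by auto

lemma colour_range: "\<epsilon> \<in> edges G \<Longrightarrow> colour \<epsilon> \<in> {1..e}"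
  using \<phi>_range[of "position (gadget \<epsilon>) ` \<epsilon>"] edge_G(4)[of \<epsilon>] by (auto simp: colour_def gadget_colour_def)

lemma simple_G: "simple_graph G"
  unfolding simple_graph_def
proof
  show "finite (verts G)"
    using simple by (auto simp: G_def A_def gadgets_def core_def simple_graph_def)
  show "edges G \<subseteq> {{u, v} | u v. u \<in> verts G \<and> v \<in> verts G \<and> u \<noteq> v}"
  proof
    fix \<epsilon> assume \<epsilon>: "\<epsilon> \<in> edges G"
    have "\<epsilon> \<subseteq> verts G" using edge_G(2,3)[OF \<epsilon>] cell_subset by blast
    then show "\<epsilon> \<in> {{u, v} | u v. u \<in> verts G \<and> v \<in> verts G \<and> u \<noteq> v}"
      using edge_G(1)[OF \<epsilon>] by (auto simp: card_2_iff)
  qed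
qed

lemma G_independent: "{Inr m, Inr m'} \<notin> edges G"
  using edge_G(5)[of "{Inr m, Inr m'}"] by auto

section \<open>New edges between outside vertices\<close>

lemma copy_if_roles_differ:
  assumes m: "m < N" "m' < N" and j: "j < L" "bit m j" "\<not> bit m' j" and i: "i \<ge> 1"
  shows "has_rainbow_copy H (add_edge {Inr m, Inr m'} G) (colour({Inr m, Inr m'} := i))"
proof -
  \<comment> \<open>The gadget \<open>(i, j)\<close> avoids the colour \<open>i\<close> of the new
    edge. For \<open>i \<ge> e\<close> the gadget \<open>(e, j)\<close> does so, since no
    substitution happens in it and all its colours are below \<open>e\<close>.\<close>
  define g where "g = (if i < e then i else e, j)"
  define h :: "'a \<Rightarrow> (nat \<times> nat) \<times> 'a + nat" where
    "h v = (if v = x then Inr m else if v = y then Inr m' else Inl (g, v))" for v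
  have e: "e \<ge> 1" using \<phi>_range[OF xy(1)] by simp
  have g: "g \<in> gadgets" using i j e by (auto simp: g_def gadgets_def)
  have pos: "position g (h v) = v" for v
    using j by (auto simp: h_def role_def g_def)
  have inj: "inj h" using pos by (metis injI)
  have cell: "h v \<in> cell g" if "v \<in> verts H" for v
    using that m by (auto simp: h_def cell_def core_def)
  have img: "position g ` h ` f = f" for f
    using pos by (simp add: image_comp comp_def)
  have edge: "h ` f \<in> edges G" "colour (h ` f) = gadget_colour g f" if f: "f \<in> edges H - {{x, y}}" for f
  proof -
    have 1: "h ` f \<subseteq> cell g" using f simple_graph_edge_subset[OF simple] cell by blast
    have 2: "position g ` h ` f \<in> edges H - {{x, y}}" using img f by simp
    have 3: "card (h ` f) = 2"
      using f simple_graph_card_edge[OF simple] inj by (simp add: card_image inj_on_subset[OF inj])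
    show "h ` f \<in> edges G"
      unfolding G_def sgraph.simps mem_Collect_eq using 1 2 3 g by blast
    show "colour (h ` f) = gadget_colour g f"
      using gadget_eq(1)[OF 1 2] img by (simp add: colour_def)
  qed
  have hxy: "h x = Inr m" "h y = Inr m'" using xy by (auto simp: h_def)
  have "has_rainbow_copy H (add_edge {h x, h y} G) (colour({h x, h y} := i))"
  proof (rule rainbow_copy_add_edge[OF simple xy(1), where k = "gadget_colour g"])
    show "inj_on h (verts H)" using inj by (rule inj_on_subset) simp
    show "h ` verts H \<subseteq> verts G" using cell cell_subset[OF g] by blast
    show "{h x, h y} \<notin> edges G" using G_independent by (simp add: hxy)
    show "h ` f \<in> edges G \<and> colour (h ` f) = gadget_colour g f \<and> gadget_colour g f \<noteq> i"
      if f: "f \<in> edges H - {{x, y}}" for f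
      using edge[OF f] \<phi>_neq_e[OF f] \<phi>_range[of f] f by (auto simp: gadget_colour_def g_def)
    show "inj_on (gadget_colour g) (edges H - {{x, y}})"
    proof (rule inj_onI)
      fix f f' assume f: "f \<in> edges H - {{x, y}}" "f' \<in> edges H - {{x, y}}"
        "gadget_colour g f = gadget_colour g f'"
      then show "f = f'"
        using \<phi>_neq_e[OF f(1)] \<phi>_neq_e[OF f(2)] \<phi>_eq_iff[of f f'] unfolding gadget_colour_def
        by (metis DiffD1)
    qed
  qed
  then show ?thesis by (simp add: hxy)
qed

text \<open>Distinct numbers differ in a binary digit; whichever of \<open>m\<close> and
  \<open>m'\<close> has the digit set plays \<open>x\<close>.\<close>

lemma G_addable:
  assumes m: "m < N" "m' < N" "m \<noteq> m'" and i: "i \<ge> 1"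
  shows "has_rainbow_copy H (add_edge {Inr m, Inr m'} G) (colour({Inr m, Inr m'} := i))"
proof -
  obtain j where j: "bit m j \<noteq> bit m' j" using m(3) by (metis bit_eqI)
  have "m < 2 ^ L" "m' < 2 ^ L" using m N_le by auto
  then have "j < L" using j bit_lt_exponent by blast
  then show ?thesis
    using copy_if_roles_differ[of m m' j i] copy_if_roles_differ[of m' m j i] m i j
    by (cases "bit m j") (auto simp: insert_commute)
qed

section \<open>Incidences, and the exclusion of rainbow copies\<close>

lemma Inl_mem_iff:
  assumes "\<epsilon> \<in> edges G" "a \<in> core"
  shows "a \<in> position (gadget \<epsilon>) ` \<epsilon> \<longleftrightarrow> Inl (gadget \<epsilon>, a) \<in> \<epsilon>"
proof
  assume "a \<in> position (gadget \<epsilon>) ` \<epsilon>"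
  then obtain v where "v \<in> \<epsilon>" "position (gadget \<epsilon>) v = a" by blast
  then show "Inl (gadget \<epsilon>, a) \<in> \<epsilon>"
    using edge_G(3)[OF assms(1)] cell_Inl[of v "gadget \<epsilon>"] assms(2) by auto
next
  assume "Inl (gadget \<epsilon>, a) \<in> \<epsilon>"
  then show "a \<in> position (gadget \<epsilon>) ` \<epsilon>"
    by (rule image_eqI[rotated]) simp
qed

lemma Inl_mem_gadget:
  assumes "\<epsilon> \<in> edges G" "Inl (g, a) \<in> \<epsilon>"
  shows "g = gadget \<epsilon>"
  using edge_G(3)[OF assms(1)] assms(2) by (auto simp: cell_def)

text \<open>Outside vertices are the only ones in a cell with role \<open>x\<close> or
  \<open>y\<close>. In a copy with a single outside vertex, its degree becomes a count of
  positions.\<close>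

lemma Inr_mem_iff:
  assumes "\<epsilon> \<in> edges G"
  shows "x \<in> position (gadget \<epsilon>) ` \<epsilon> \<or> y \<in> position (gadget \<epsilon>) ` \<epsilon> \<longleftrightarrow> (\<exists>m. Inr m \<in> \<epsilon>)"
proof
  assume "x \<in> position (gadget \<epsilon>) ` \<epsilon> \<or> y \<in> position (gadget \<epsilon>) ` \<epsilon>"
  then obtain v where "v \<in> \<epsilon>" "position (gadget \<epsilon>) v \<in> {x, y}" by auto
  then show "\<exists>m. Inr m \<in> \<epsilon>"
    using edge_G(3)[OF assms] by (auto simp: cell_def core_def)
next
  assume "\<exists>m. Inr m \<in> \<epsilon>"
  then obtain m where "Inr m \<in> \<epsilon>" ..
  then have "role (gadget \<epsilon>) m \<in> position (gadget \<epsilon>) ` \<epsilon>" by (metis imageI position_simps(2))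
  then show "x \<in> position (gadget \<epsilon>) ` \<epsilon> \<or> y \<in> position (gadget \<epsilon>) ` \<epsilon>"
    by (auto simp: role_def split: if_splits)
qed

lemma card_core: "card core + 2 = card (verts H)"
proof -
  have "finite (verts H)" using simple by (simp add: simple_graph_def)
  moreover have "card (verts H) \<ge> card {x, y}"
    using xy_verts \<open>finite (verts H)\<close> by (intro card_mono) auto
  ultimately show ?thesis
    using xy_verts xy(2) by (simp add: core_def card_Diff_subset)
qed

text \<open>No edge except \<open>{x, y}\<close> contains both vertices, so the edges at
  \<open>x\<close> and at \<open>y\<close> are counted separately.\<close>

lemma card_edges_at_xy:
  "card {f \<in> edges H - {{x, y}}. x \<in> f \<or> y \<in> f} = (degree H x - 1) + (degree H y - 1)"
proof -
  let ?S = "\<lambda>v. {f \<in> edges H. v \<in> f} - {{x, y}}"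
  have "{f \<in> edges H - {{x, y}}. x \<in> f \<or> y \<in> f} = ?S x \<union> ?S y" by auto
  moreover have "f = {x, y}" if f: "f \<in> edges H" "x \<in> f" "y \<in> f" for f
  proof -
    obtain z where "f = {x, z}" "x \<noteq> z" "x \<in> verts H" "z \<in> verts H"
      using simple_graph_edge_other[OF simple f(1,2)] .
    then show ?thesis using f(3) xy(2) by auto
  qed
  then have "?S x \<inter> ?S y = {}" by blast
  moreover have "card (?S v) = degree H v - 1" if "v \<in> {x, y}" for v
    using that xy finite_edges unfolding degree_def by (subst card_Diff_singleton) auto
  ultimately show ?thesis
    using finite_edges by (simp add: card_Un_disjoint)
qed

text \<open>
  A rainbow copy uses all \<open>e\<close> colours, so it realises every position except \<open>{x, y}\<close> once and one
  position a second time, in another gadget. Counting vertices, it has one vertex outside \<open>A\<close> and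
  exactly one core position \<open>w\<close> is occupied twice.
\<close>

lemma G_free: "\<not> has_rainbow_copy H G colour"
proof
  assume "has_rainbow_copy H G colour"
  then obtain h where h: "rainbow_embedding h H G colour"
    using has_rainbow_copy_iff[OF simple] by blast
  let ?E = "edges H"
  define P where "P f = position (gadget (h ` f)) ` h ` f" for f
  define \<gamma> where "\<gamma> f = gadget (h ` f)" for f
  define \<kappa> where "\<kappa> = (\<lambda>f. colour (h ` f))"
  have inj_h: "inj_on h (verts H)" and hE: "\<And>f. f \<in> ?E \<Longrightarrow> h ` f \<in> edges G" and inj_\<kappa>: "inj_on \<kappa> ?E"
    using h by (auto simp: rainbow_embedding_def \<kappa>_def)
  have P: "P f \<in> ?E - {{x, y}}" if "f \<in> ?E" for f
    using edge_G(4)[OF hE[OF that]] by (simp add: P_def)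
  have \<kappa>_eq: "\<kappa> f = (if \<phi> (P f) = fst (\<gamma> f) then e else \<phi> (P f))" for f
    by (simp add: \<kappa>_def colour_def gadget_colour_def P_def \<gamma>_def)
  \<comment> \<open>The \<open>e\<close> edges of the copy have distinct colours among
    \<open>e\<close> possible ones, so every colour occurs.\<close>
  have "\<kappa> ` ?E = {1..e}"
    using colour_range hE inj_\<kappa> by (intro card_subset_eq) (auto simp: \<kappa>_def card_image)
  have \<kappa>_onto: "\<exists>f \<in> ?E. \<kappa> f = k" if "k \<in> {1..e}" for k
    using that unfolding \<open>\<kappa> ` ?E = {1..e}\<close>[symmetric] by auto
  obtain e0 where e0: "e0 \<in> ?E" "\<kappa> e0 = e"
    using \<kappa>_onto[of e] \<phi>_range[OF xy(1)] by auto
  \<comment> \<open>Colour \<open>e\<close> arises only by substitution, and \<open>e0\<close> alone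
    has it; every other edge carries the colour of its position.\<close>
  have \<kappa>_P: "\<kappa> f = \<phi> (P f)" "\<phi> (P f) \<noteq> fst (\<gamma> f)" if "f \<in> ?E - {e0}" for f
    using that e0 inj_onD[OF inj_\<kappa>, of f e0] \<kappa>_eq[of f] by auto
  have bij_P: "bij_betw P (?E - {e0}) (?E - {{x, y}})"
  proof (rule bij_betw_imageI)
    show "inj_on P (?E - {e0})"
      using \<kappa>_P(1) inj_\<kappa> by (metis (no_types, lifting) DiffD1 inj_on_def)
    show "P ` (?E - {e0}) = ?E - {{x, y}}"
    proof
      show "P ` (?E - {e0}) \<subseteq> ?E - {{x, y}}" using P by blast
      show "?E - {{x, y}} \<subseteq> P ` (?E - {e0})"
      proof
        fix f assume f: "f \<in> ?E - {{x, y}}"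
        then obtain f' where f': "f' \<in> ?E" "\<kappa> f' = \<phi> f" using \<kappa>_onto \<phi>_range by blast
        then have "f' \<noteq> e0" using \<phi>_neq_e[OF f] e0 by auto
        then show "f \<in> P ` (?E - {e0})"
          using \<kappa>_P(1)[of f'] f' \<phi>_eq_iff[of f "P f'"] P[of f'] f by auto
      qed
    qed
  qed
  obtain e1 where e1: "e1 \<in> ?E - {e0}" "P e1 = P e0"
    using bij_P P[OF e0(1)] by (metis bij_betw_def imageE)
  \<comment> \<open>The gadget of \<open>e0\<close> omits the colour of the common position; the
    gadget of \<open>e1\<close> does not.\<close>
  have \<gamma>_neq: "\<gamma> e1 \<noteq> \<gamma> e0"
    using \<kappa>_P(2)[OF e1(1)] e1(2) \<kappa>_eq[of e0] e0(2) \<phi>_neq_e[OF P[OF e0(1)]] by (auto split: if_splits)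

  define T where "T = h ` verts H"
  have fin_T: "finite T" using simple by (simp add: T_def simple_graph_def)
  have card_T: "card T = card core + 2"
    using inj_h card_core by (simp add: T_def card_image)
  have hT: "h ` f \<subseteq> T" if "f \<in> ?E" for f
    using simple_graph_edge_subset[OF simple that] by (auto simp: T_def)
  have Inl_iff: "a \<in> P f \<longleftrightarrow> Inl (\<gamma> f, a) \<in> h ` f" if "f \<in> ?E" "a \<in> core" for f a
    using Inl_mem_iff[OF hE[OF that(1)] that(2)] by (simp add: P_def \<gamma>_def)
  have Inl_T: "Inl (\<gamma> f, a) \<in> T" if "f \<in> ?E" "a \<in> core" "a \<in> P f" for f a
    using Inl_iff hT that by blast
  have "\<exists>f \<in> ?E. a \<in> P f" if a: "a \<in> core" for a
  proof -
    obtain f where "f \<in> ?E" "a \<in> f"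
      using no_isolated a by (auto simp: isolated_vertex_def core_def)
    then have "f \<in> ?E - {{x, y}}" using a by (auto simp: core_def)
    then show ?thesis
      using bij_P \<open>a \<in> f\<close> unfolding bij_betw_def by (metis DiffD1 imageE)
  qed
  then obtain \<eta> where \<eta>: "\<And>a. a \<in> core \<Longrightarrow> \<eta> a \<in> ?E \<and> a \<in> P (\<eta> a)" by metis
  \<comment> \<open>One vertex of the copy is selected at each core position.\<close>
  define s :: "'a \<Rightarrow> (nat \<times> nat) \<times> 'a + nat" where "s a = Inl (\<gamma> (\<eta> a), a)" for a
  have s_T: "s ` core \<subseteq> T" using \<eta> Inl_T by (auto simp: s_def)
  have card_s: "card (s ` core) = card core"
    by (intro card_image) (auto simp: s_def inj_on_def)
  have fin_core: "finite core" using simple by (simp add: core_def simple_graph_def)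

  obtain w where w: "w \<in> P e0" "w \<in> core"
    using edge_core[OF P[OF e0(1)]] .
  \<comment> \<open>\<open>e0\<close> and \<open>e1\<close> put vertices of two different gadgets at
    \<open>w\<close>, and \<open>s\<close> selects at most one of them.\<close>
  have "\<exists>u \<in> T - s ` core. \<exists>g. u = Inl (g, w)"
  proof -
    have "Inl (\<gamma> e0, w) \<in> T" "Inl (\<gamma> e1, w) \<in> T"
      using Inl_T e0 e1 w by auto
    moreover have "Inl (\<gamma> e0, w) \<notin> s ` core \<or> Inl (\<gamma> e1, w) \<notin> s ` core"
      using \<gamma>_neq by (auto simp: s_def)
    ultimately show ?thesis by blast
  qed
  then obtain u gu where u: "u \<in> T - s ` core" "u = Inl (gu, w)" by blast
  have "\<exists>m. Inr m \<in> T"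
  proof -
    have "{f \<in> ?E - {{x, y}}. x \<in> f \<or> y \<in> f} \<noteq> {}"
      using card_edges_at_xy deg_x by (metis (no_types, lifting) Suc_1 add_is_0 card.empty diff_is_0_eq not_less_eq_eq)
    then obtain f where f: "f \<in> ?E - {{x, y}}" "x \<in> f \<or> y \<in> f" by auto
    then obtain f' where "f' \<in> ?E" "P f' = f"
      using bij_P unfolding bij_betw_def by (metis DiffD1 imageE)
    then show ?thesis
      using Inr_mem_iff[OF hE] f(2) hT unfolding P_def by blast
  qed
  then obtain m where m: "Inr m \<in> T" ..
  define p :: "(nat \<times> nat) \<times> 'a + nat" where "p = Inr m"
  \<comment> \<open>The copy has only \<open>card core + 2\<close> vertices, so nothing else
    fits.\<close>
  have "s ` core \<union> {u, p} = T"
  proof (rule card_subset_eq[OF fin_T])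
    show "s ` core \<union> {u, p} \<subseteq> T" using s_T u m by (auto simp: p_def)
    have "s ` core \<inter> {u, p} = {}" using u by (auto simp: s_def p_def)
    moreover have "u \<noteq> p" using u by (simp add: p_def)
    ultimately show "card (s ` core \<union> {u, p}) = card T"
      using fin_core card_s card_T by (simp add: card_Un_disjoint)
  qed
  then have T_Inr: "\<And>m'. Inr m' \<in> T \<Longrightarrow> Inr m' = p" and T_Inl: "\<And>g a. Inl (g, a) \<in> T \<Longrightarrow> a \<noteq> w \<Longrightarrow> Inl (g, a) = s a"
    using u by (auto simp: s_def p_def)

  have Pe0: "P e0 \<in> ?E" using P[OF e0(1)] by simp
  obtain r where r: "P e0 = {w, r}" "w \<noteq> r" "w \<in> verts H" "r \<in> verts H"
    using simple_graph_edge_other[OF simple Pe0 w(1)] .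
  \<comment> \<open>Otherwise \<open>r\<close> would be a second core position occupied in two
    gadgets.\<close>
  have "r \<notin> core"
  proof
    assume "r \<in> core"
    then have "Inl (\<gamma> e0, r) \<in> T" "Inl (\<gamma> e1, r) \<in> T"
      using Inl_T e0 e1 r by auto
    then show False using T_Inl r(2) \<gamma>_neq by (metis Pair_inject sum.inject(1))
  qed
  then have r_xy: "r \<in> {x, y}" using r by (auto simp: core_def)

  \<comment> \<open>The count of \<open>card_edges_at_xy\<close> plus one: the outside vertex
    \<open>p\<close> also lies on the image of the additional edge \<open>e0\<close>.\<close>
  let ?D = "degree H x + degree H y - 1"
  have deg_h: "degree H q = card {f \<in> ?E. h q \<in> h ` f}" if "q \<in> verts H" for q
  proof -
    have "q \<in> f \<longleftrightarrow> h q \<in> h ` f" if "f \<in> ?E" for f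
      using inj_on_image_mem_iff[OF inj_h \<open>q \<in> verts H\<close>] simple_graph_edge_subset[OF simple that] by blast
    then show ?thesis unfolding degree_def by (metis (mono_tags, lifting))
  qed
  have card_P: "card {f \<in> ?E - {e0}. Q (P f)} = card {f \<in> ?E - {{x, y}}. Q f}" for Q
  proof -
    have img: "P ` (?E - {e0}) = ?E - {{x, y}}"
      using bij_P by (simp add: bij_betw_def)
    have "P ` {f \<in> ?E - {e0}. Q (P f)} = {f \<in> ?E - {{x, y}}. Q f}"
      unfolding img[symmetric] by blast
    moreover have "inj_on P {f \<in> ?E - {e0}. Q (P f)}"
      by (rule inj_on_subset[OF bij_betw_imp_inj_on[OF bij_P]]) blast
    ultimately show ?thesis using card_image[of P "{f \<in> ?E - {e0}. Q (P f)}"] by simp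
  qed
  obtain q0 where q0: "q0 \<in> verts H" "h q0 = p"
    using m by (auto simp: T_def p_def)
  have deg_q0: "degree H q0 = ?D"
  proof -
    let ?Q = "\<lambda>f. x \<in> f \<or> y \<in> f"
    have "p \<in> h ` f \<longleftrightarrow> ?Q (P f)" if "f \<in> ?E" for f
      using Inr_mem_iff[OF hE[OF that]] T_Inr hT[OF that] unfolding P_def p_def by blast
    then have "{f \<in> ?E. h q0 \<in> h ` f} = insert e0 {f \<in> ?E - {e0}. ?Q (P f)}"
      using e0(1) r(1) r_xy q0(2) by auto
    then have "degree H q0 = Suc (card {f \<in> ?E - {{x, y}}. ?Q f})"
      using deg_h[OF q0(1)] card_P[of ?Q] finite_edges by simp
    then show ?thesis
      using card_edges_at_xy deg_x deg_y by simp
  qed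
  define \<sigma> where "\<sigma> a = the_inv_into (verts H) h (s a)" for a
  have h_\<sigma>: "h (\<sigma> a) = s a" "\<sigma> a \<in> verts H" if "a \<in> core" for a
    using that s_T inj_h f_the_inv_into_f[OF inj_h, of "s a"] the_inv_into_into[OF inj_h, of "s a" "verts H"]
    by (auto simp: \<sigma>_def T_def image_subset_iff)
  \<comment> \<open>Away from \<open>w\<close> each core position is held by one vertex, and
    \<open>e0\<close> does not touch it since its position is \<open>{w, r}\<close>. So degrees are
    preserved.\<close>
  have deg_\<sigma>: "degree H (\<sigma> a) = degree H a" if "a \<in> core" "a \<noteq> w" for a
  proof -
    have "s a \<in> h ` f \<longleftrightarrow> a \<in> P f" if f: "f \<in> ?E" for f
    proof
      assume "s a \<in> h ` f"
      then show "a \<in> P f"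
        using Inl_mem_gadget[OF hE[OF f]] Inl_iff[OF f \<open>a \<in> core\<close>] by (auto simp: s_def \<gamma>_def)
    next
      assume "a \<in> P f"
      then have *: "Inl (\<gamma> f, a) \<in> h ` f" using Inl_iff[OF f \<open>a \<in> core\<close>] by simp
      then have "Inl (\<gamma> f, a) = s a" using T_Inl \<open>a \<noteq> w\<close> hT[OF f] by blast
      with * show "s a \<in> h ` f" by simp
    qed
    moreover have "a \<notin> P e0" using that r \<open>r \<notin> core\<close> by auto
    ultimately have "{f \<in> ?E. h (\<sigma> a) \<in> h ` f} = {f \<in> ?E - {e0}. a \<in> P f}"
      using h_\<sigma>[OF that(1)] by auto
    then have "degree H (\<sigma> a) = card {f \<in> ?E - {{x, y}}. a \<in> f}"
      using deg_h h_\<sigma> that card_P by simp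
    also have "{f \<in> ?E - {{x, y}}. a \<in> f} = {f \<in> ?E. a \<in> f}"
      using that by (auto simp: core_def)
    finally show ?thesis by (simp add: degree_def)
  qed
  have deg_w: "degree H w = ?D"
  proof (rule ccontr)
    assume "degree H w \<noteq> ?D"
    \<comment> \<open>Both \<open>x\<close> and \<open>y\<close> have degree below
      \<open>?D\<close>, so \<open>\<sigma>\<close> is an injection of \<open>S\<close> into itself,
      hence onto. Yet \<open>q0\<close> lies in \<open>S\<close> and is not a value of
      \<open>\<sigma>\<close>, because \<open>h\<close> sends it outside \<open>A\<close>.\<close>
    define S where "S = {v \<in> verts H. degree H v = ?D}"
    have S: "S \<subseteq> core - {w}"
      using \<open>degree H w \<noteq> ?D\<close> deg_x deg_y by (auto simp: S_def core_def)
    have "\<sigma> ` S \<subseteq> S"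
    proof
      fix v assume "v \<in> \<sigma> ` S"
      then obtain a where a: "a \<in> S" "v = \<sigma> a" by blast
      then have "a \<in> core" "a \<noteq> w" using S by auto
      then show "v \<in> S" using a deg_\<sigma> h_\<sigma>(2) by (simp add: S_def)
    qed
    moreover have "inj_on \<sigma> S"
    proof (rule inj_onI)
      fix a b assume "a \<in> S" "b \<in> S" "\<sigma> a = \<sigma> b"
      then have "s a = s b" using h_\<sigma>(1) S by (metis DiffD1 subsetD)
      then show "a = b" by (simp add: s_def)
    qed
    ultimately have "\<sigma> ` S = S"
      using endo_inj_surj[of S \<sigma>] S fin_core by (metis finite_Diff finite_subset)
    moreover have "q0 \<in> S" using q0 deg_q0 by (simp add: S_def)
    ultimately obtain a where "a \<in> S" "q0 = \<sigma> a" by blast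
    then show False using h_\<sigma>(1) S q0(2) by (auto simp: s_def p_def)
  qed
  \<comment> \<open>The degree sum of this edge exceeds that of \<open>{x, y}\<close>.\<close>
  have "{w, r} \<in> ?E" using P[OF e0(1)] r(1) by simp
  moreover have "degree H r \<ge> 2" using r_xy deg_x deg_y by auto
  ultimately have "degree H w + degree H r \<le> degree H x + degree H y"
    using deg_w deg_x deg_y by (intro maximal) simp_all
  then show False using deg_w deg_x deg_y \<open>degree H r \<ge> 2\<close> by simp
qed

lemma rainbow_sat_bound:
  assumes t: "t \<ge> e"
  shows "rainbow_sat t (card A + N) H \<le> card A * (card A + N)"
proof -
  have fin: "finite A"
    using simple by (auto simp: A_def gadgets_def core_def simple_graph_def)
  have card: "card (verts G) = card A + N"
  proof -
    have "card (A \<union> Inr ` {..<N}) = card A + card ((Inr :: nat \<Rightarrow> (nat \<times> nat) \<times> 'a + nat) ` {..<N})"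
      using fin by (intro card_Un_disjoint) (auto simp: A_def)
    then show ?thesis by (simp add: G_def card_image)
  qed
  have B: "\<exists>m < N. u = Inr m" if "u \<in> verts G - A" for u
    using that by (auto simp: G_def)
  have "rainbow_sat t (card (verts G)) H \<le> card A * card (verts G)"
  proof (rule rainbow_sat_le[OF simple _ G_free])
    show "coloured_graph t G colour"
      using simple_G colour_range t by (fastforce simp: coloured_graph_def)
    show "A \<subseteq> verts G" by (simp add: G_def)
    show "{u, v} \<notin> edges G" if "u \<in> verts G - A" "v \<in> verts G - A" for u v
      using B[OF that(1)] B[OF that(2)] G_independent by blast
    show "has_rainbow_copy H (add_edge {u, v} G) (colour({u, v} := i))"
      if "u \<in> verts G - A" "v \<in> verts G - A" "u \<noteq> v" "i \<in> {1..t}" for u v i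
      using B[OF that(1)] B[OF that(2)] G_addable that by auto
  qed
  then show ?thesis by (simp add: card)
qed

lemma card_A: "card A = e * L * card core"
  by (simp add: A_def gadgets_def card_image card_cartesian_product)

end

section \<open>Star forests\<close>

text \<open>
  With an isolated edge \<open>{x, y}\<close> and a leaf in every edge, the vertex \<open>x\<close> serves as a spare copy of any
  leaf, attached in colour \<open>card (edges H)\<close>; all vertices outside \<open>verts H - {y}\<close> are isolated.
\<close>

lemma rainbow_sat_isolated_edge:
  fixes H :: "'a sgraph"
  assumes H: "simple_graph H" and no_isolated: "\<nexists>v. isolated_vertex H v"
    and xy: "{x, y} \<in> edges H" "x \<noteq> y" "degree H x = 1" "degree H y = 1"
    and leaf: "\<And>f. f \<in> edges H \<Longrightarrow> \<exists>v \<in> f. degree H v = 1"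
    and t: "t \<ge> card (edges H)"
  shows "rainbow_sat t (card (verts H) + N) H \<le> card (verts H) * (card (verts H) + N)"
proof -
  let ?e = "card (edges H)"
  have finE: "finite (edges H)" and finV: "finite (verts H)"
    using H by (auto intro: simple_graph_finite_edges simp: simple_graph_def)
  obtain \<phi> where \<phi>: "bij_betw \<phi> (edges H) {1..?e}" "\<phi> {x, y} = ?e"
    using ex_bij_last[OF finE xy(1)] .
  have \<phi>_range: "\<phi> f \<in> {1..?e}" if "f \<in> edges H" for f
    using \<phi>(1) that by (auto simp: bij_betw_def)
  have inj_\<phi>: "inj_on \<phi> (edges H)" using \<phi>(1) by (simp add: bij_betw_def)
  have e_pos: "?e \<ge> 1" using xy(1) finE by (auto simp: Suc_le_eq card_gt_0_iff)
  let ?E = "edges H - {{x, y}}"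
  have \<phi>_less: "\<phi> f < ?e" if "f \<in> ?E" for f
    using \<phi>_range[of f] inj_onD[OF inj_\<phi>, of f "{x, y}"] that xy(1) \<phi>(2) by (auto simp: order_less_le)
  have notin: "x \<notin> f" "y \<notin> f" if "f \<in> ?E" for f
    using degree_1_unique[OF xy(3) _ xy(1)] degree_1_unique[OF xy(4) _ xy(1)] that by auto
  have xyV: "x \<in> verts H" "y \<in> verts H"
    using simple_graph_edge_subset[OF H xy(1)] by auto

  define F where "F = ?E \<union> {{a, x} | a. a \<in> verts H - {x, y}}"
  define A where "A = (Inl ` verts H :: ('a + nat) set)"
  define G where "G = \<lparr>verts = A \<union> Inr ` {..<N}, edges = (`) Inl ` F\<rparr>"
  define k where "k f = (if x \<in> f then ?e else \<phi> f)" for f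
  define c where "c = (\<lambda>\<epsilon> :: ('a + nat) set. k (Inl -` \<epsilon>))"
  have c_Inl: "c (Inl ` f) = k f" for f
    by (simp add: c_def inj_vimage_image_eq)
  have F: "f \<subseteq> verts H - {y}" if f: "f \<in> F" for f
  proof (cases "f \<in> ?E")
    case True
    then show ?thesis using simple_graph_edge_subset[OF H, of f] notin(2)[OF True] by auto
  next
    case False
    then show ?thesis using f xyV xy(2) by (auto simp: F_def)
  qed
  have "simple_graph G"
    unfolding simple_graph_def
  proof
    show "finite (verts G)" using finV by (simp add: G_def A_def)
    show "edges G \<subseteq> {{u, v} | u v. u \<in> verts G \<and> v \<in> verts G \<and> u \<noteq> v}"
    proof
      fix \<epsilon> assume "\<epsilon> \<in> edges G"
      then obtain f where f: "f \<in> F" "\<epsilon> = Inl ` f" by (auto simp: G_def)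
      obtain a b where "f = {a, b}" "a \<noteq> b"
      proof (cases "f \<in> ?E")
        case True
        then show thesis using simple_graph_edgeE[OF H, of f] that by blast
      next
        case False
        then show thesis using f that unfolding F_def by blast
      qed
      then show "\<epsilon> \<in> {{u, v} | u v. u \<in> verts G \<and> v \<in> verts G \<and> u \<noteq> v}"
        using f F[OF f(1)] by (auto simp: G_def A_def)
    qed
  qed
  moreover have "c \<in> edges G \<rightarrow> {1..t}"
  proof
    fix \<epsilon> assume "\<epsilon> \<in> edges G"
    then obtain f where f: "f \<in> F" "\<epsilon> = Inl ` f" by (auto simp: G_def)
    then have "x \<in> f \<or> f \<in> edges H" by (auto simp: F_def)
    then show "c \<epsilon> \<in> {1..t}"
      using \<phi>_range[of f] e_pos t by (auto simp: f(2) c_Inl k_def)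
  qed
  ultimately have col: "coloured_graph t G c" by (simp add: coloured_graph_def)

  have free: "\<not> has_rainbow_copy H G c"
  proof
    assume "has_rainbow_copy H G c"
    then obtain h where "rainbow_embedding h H G c"
      using has_rainbow_copy_iff[OF H] by blast
    then have h: "inj_on h (verts H)" "\<And>f. f \<in> edges H \<Longrightarrow> h ` f \<in> edges G"
      by (auto simp: rainbow_embedding_def)
    \<comment> \<open>No vertex of a copy is isolated, and \<open>G\<close> has too few vertices
      that are not.\<close>
    have "h ` verts H \<subseteq> Inl ` (verts H - {y})"
    proof
      fix u assume "u \<in> h ` verts H"
      then obtain v where v: "v \<in> verts H" "u = h v" by blast
      then obtain f where "f \<in> edges H" "v \<in> f"
        using no_isolated by (auto simp: isolated_vertex_def)
      then have "u \<in> h ` f" "h ` f \<in> (`) Inl ` F" using v h(2)[of f] by (auto simp: G_def)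
      then show "u \<in> Inl ` (verts H - {y})" using F by blast
    qed
    then have "card (h ` verts H) \<le> card ((Inl :: 'a \<Rightarrow> 'a + nat) ` (verts H - {y}))"
      using finV by (intro card_mono) auto
    then have "card (verts H) \<le> card (verts H - {y})"
      using h(1) by (simp add: card_image)
    then show False using card_Diff1_less[OF finV xyV(2)] by simp
  qed

  have add: "has_rainbow_copy H (add_edge {Inr m, Inr m'} G) (c({Inr m, Inr m'} := i))"
    if m: "m < N" "m' < N" "m \<noteq> m'" and i: "i \<in> {1..t}" for m m' i
  proof -
    \<comment> \<open>\<open>b\<close> is the leaf of the old edge coloured \<open>i\<close>, or
      \<open>y\<close> if no old edge has that colour.\<close>
    obtain b where b: "b \<in> verts H" "b \<noteq> x" "\<And>f. f \<in> ?E \<Longrightarrow> b \<in> f \<longleftrightarrow> \<phi> f = i"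
    proof (cases "i < ?e")
      case True
      then obtain f where f: "f \<in> edges H" "\<phi> f = i"
        using \<phi>(1) i by (metis (no_types, lifting) atLeastAtMost_iff bij_betw_def imageE less_imp_le)
      then have fE: "f \<in> ?E" using True \<phi>(2) by auto
      obtain b where b: "b \<in> f" "degree H b = 1" using leaf[OF f(1)] by blast
      have "b \<in> f' \<longleftrightarrow> \<phi> f' = i" if "f' \<in> ?E" for f'
        using degree_1_unique[OF b(2) f(1) _ b(1), of f'] inj_onD[OF inj_\<phi>, of f f'] f b that by blast
      then show thesis
        using that b notin[OF fE] simple_graph_edge_subset[OF H f(1)] by blast
    next
      case False
      have "y \<in> f \<longleftrightarrow> \<phi> f = i" if "f \<in> ?E" for f
        using notin[OF that] \<phi>_less[OF that] False by auto
      then show thesis using that xyV xy(2) by blast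
    qed
    \<comment> \<open>The old edge coloured \<open>i\<close> is swung from its leaf \<open>b\<close>
      to \<open>x\<close>, where it gets colour \<open>?e\<close>. If \<open>b = y\<close>, the test
      for \<open>y\<close> comes first and no edge is swung.\<close>
    define h :: "'a \<Rightarrow> 'a + nat" where
      "h v = (if v = x then Inr m else if v = y then Inr m' else if v = b then Inl x else Inl v)" for v
    have hx: "h x = Inr m" and hy: "h y = Inr m'" using xy(2) by (auto simp: h_def)
    have "has_rainbow_copy H (add_edge {h x, h y} G) (c({h x, h y} := i))"
    proof (rule rainbow_copy_add_edge[OF H xy(1), where k = "\<lambda>f. if b \<in> f then ?e else \<phi> f"])
      show "inj_on h (verts H)"
        using m(3) by (auto simp: inj_on_def h_def split: if_splits)
      show "h ` verts H \<subseteq> verts G" using m xyV by (auto simp: h_def G_def A_def)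
      show "{h x, h y} \<notin> edges G" using hx by (auto simp: G_def)
      show "h ` f \<in> edges G \<and> c (h ` f) = (if b \<in> f then ?e else \<phi> f) \<and> (if b \<in> f then ?e else \<phi> f) \<noteq> i"
        if f: "f \<in> ?E" for f
      proof (cases "b \<in> f")
        case False
        then have "h ` f = Inl ` f"
          using notin[OF f] by (intro image_cong) (auto simp: h_def)
        then show ?thesis
          using False f b(3)[OF f] notin[OF f] by (auto simp: c_Inl k_def G_def F_def)
      next
        case True
        have fH: "f \<in> edges H" using f by simp
        obtain a where a: "f = {b, a}" "b \<noteq> a" "b \<in> verts H" "a \<in> verts H"
          using simple_graph_edge_other[OF H fH True] .
        then have "h ` f = Inl ` {a, x}" "a \<notin> {x, y}"
          using notin[OF f] by (auto simp: h_def)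
        moreover have "{a, x} \<in> F" using a \<open>a \<notin> {x, y}\<close> by (auto simp: F_def)
        ultimately show ?thesis
          using True b(3)[OF f] \<phi>_less[OF f] by (auto simp: c_Inl k_def G_def simp del: image_insert)
      qed
      show "inj_on (\<lambda>f. if b \<in> f then ?e else \<phi> f) ?E"
      proof (rule inj_onI)
        fix f f' assume "f \<in> ?E" "f' \<in> ?E"
          "(if b \<in> f then ?e else \<phi> f) = (if b \<in> f' then ?e else \<phi> f')"
        then have "\<phi> f = \<phi> f'"
          using b(3)[of f] b(3)[of f'] \<phi>_less[of f] \<phi>_less[of f'] by (auto split: if_splits)
        then show "f = f'"
          using inj_onD[OF inj_\<phi>, of f f'] \<open>f \<in> ?E\<close> \<open>f' \<in> ?E\<close> by blast
      qed
    qed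
    then show ?thesis by (simp add: hx hy)
  qed

  have cardA: "card A = card (verts H)" by (simp add: A_def card_image)
  have "card (A \<union> Inr ` {..<N}) = card A + card ((Inr :: nat \<Rightarrow> 'a + nat) ` {..<N})"
    using finV by (intro card_Un_disjoint) (auto simp: A_def)
  then have cardV: "card (verts G) = card (verts H) + N"
    by (simp add: G_def card_image cardA)
  have B: "\<exists>m < N. u = Inr m" if "u \<in> verts G - A" for u
    using that by (auto simp: G_def)
  have "rainbow_sat t (card (verts G)) H \<le> card A * card (verts G)"
  proof (rule rainbow_sat_le[OF H col free])
    show "A \<subseteq> verts G" by (simp add: G_def)
    show "{u, v} \<notin> edges G" if "u \<in> verts G - A" "v \<in> verts G - A" for u v
      using B[OF that(1)] by (auto simp: G_def)
    show "has_rainbow_copy H (add_edge {u, v} G) (c({u, v} := i))"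
      if "u \<in> verts G - A" "v \<in> verts G - A" "u \<noteq> v" "i \<in> {1..t}" for u v i
      using B[OF that(1)] B[OF that(2)] add that by auto
  qed
  then show ?thesis by (simp add: cardV cardA)
qed

text \<open>Two stars are singled out: \<open>x\<close> with leaves \<open>y\<close>,
  \<open>w2\<close>, and \<open>c\<close> with leaves \<open>w1\<close>, \<open>z\<close>. Edges are
  numbered through their leaves, and the number of \<open>y\<close> is the spare colour.
  \<open>N_ge\<close> leaves room outside \<open>A\<close> for all vertices of \<open>H\<close>
  besides the ends of a new edge.\<close>

locale star_forest =
  fixes H :: "'a sgraph" and leaf centre :: "'a set \<Rightarrow> 'a" and x c y z w1 w2 :: 'a
    and \<phi> :: "'a \<Rightarrow> nat" and N :: nat
  assumes simple: "simple_graph H"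
    and edge: "\<And>f. f \<in> edges H \<Longrightarrow> f = {leaf f, centre f}"
    and deg_leaf: "\<And>f. f \<in> edges H \<Longrightarrow> degree H (leaf f) = 1"
    and deg_centre: "\<And>f. f \<in> edges H \<Longrightarrow> degree H (centre f) \<ge> 2"
    and deg: "degree H x \<ge> 2" "degree H c \<ge> 2" and xc: "x \<noteq> c"
    and star_edges: "{x, y} \<in> edges H" "{x, w2} \<in> edges H" "{c, w1} \<in> edges H" "{c, z} \<in> edges H"
    and distinct: "y \<noteq> w2" "w1 \<noteq> z"
    and bij_\<phi>: "bij_betw \<phi> (leaf ` edges H) {1..card (leaf ` edges H)}"
    and \<phi>_y: "\<phi> y = card (leaf ` edges H)"
    and N_ge: "N \<ge> card (verts H) + 2"
begin

abbreviation e where "e \<equiv> card (edges H)"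

definition Nc where "Nc = {v. {c, v} \<in> edges H}"

text \<open>Leaves double as vertices of \<open>G\<close>. Leaving out \<open>y\<close> makes
  \<open>A\<close> one too small for a rainbow copy and frees the colour \<open>e\<close>.\<close>

definition A :: "('a + nat) set" where "A = Inl ` (leaf ` edges H - {y})"

definition G :: "('a + nat) sgraph" where
  "G = \<lparr>verts = A \<union> Inr ` {..<N}, edges = {{u, v} | u v. u \<in> A \<and> v \<in> A \<union> Inr ` {..<N} \<and> u \<noteq> v}\<rparr>"

text \<open>
  If the new edge has the colour of a leaf \<open>j\<close>, then \<open>j\<close> must be used through another edge: it becomes a
  leaf, in colour \<open>e\<close>, of a star recentred at \<open>w1\<close> (for \<open>j \<notin> Nc\<close>) or at \<open>w2\<close> (for \<open>j \<in> Nc\<close>). The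
  remaining leaves of that star keep their own colours.
\<close>

definition \<rho>1 where "\<rho>1 b = (if b \<in> Nc then \<phi> b else e)"
definition \<rho>2 where "\<rho>2 b = (if b \<in> Nc then e else \<phi> b)"

text \<open>The value 0 is a dummy, as two outside vertices form no edge of \<open>G\<close>. On the
  pair of \<open>w1\<close> and \<open>w2\<close> both special rules give \<open>e\<close>.\<close>

fun \<kappa> :: "'a + nat \<Rightarrow> 'a + nat \<Rightarrow> nat" where
  "\<kappa> (Inl a) (Inr _) = \<phi> a"
| "\<kappa> (Inr _) (Inl a) = \<phi> a"
| "\<kappa> (Inl a) (Inl b) =
    (if a = w1 then \<rho>1 b else if b = w1 then \<rho>1 a else if a = w2 then \<rho>2 b else if b = w2 then \<rho>2 a else e)"
| "\<kappa> (Inr _) (Inr _) = 0"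

text \<open>The choice of an ordering of the edge is harmless because \<open>\<kappa>\<close> is
  symmetric.\<close>

definition colour :: "('a + nat) set \<Rightarrow> nat" where
  "colour \<epsilon> = (SOME k. \<exists>u v. \<epsilon> = {u, v} \<and> k = \<kappa> u v)"

lemma leaf_eq:
  assumes "q \<noteq> l" "{q, l} \<in> edges H" "degree H q \<ge> 2"
  shows "leaf {q, l} = l" "centre {q, l} = q"
  using edge[OF assms(2)] deg_leaf[OF assms(2)] assms by (auto simp: doubleton_eq_iff)

lemma neq: "x \<noteq> y" "x \<noteq> w2" "c \<noteq> w1" "c \<noteq> z"
  using simple_graph_card_edge[OF simple] star_edges by fastforce+

lemma leaves:
  "leaf {x, y} = y" "centre {x, y} = x" "leaf {x, w2} = w2" "centre {x, w2} = x"
  "leaf {c, w1} = w1" "centre {c, w1} = c" "leaf {c, z} = z" "centre {c, z} = c"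
  using leaf_eq neq star_edges deg by simp_all

lemma leaf_neq_centre: "f \<in> edges H \<Longrightarrow> f' \<in> edges H \<Longrightarrow> leaf f \<noteq> centre f'"
  using deg_leaf[of f] deg_centre[of f'] by auto

lemma leaf_inj: "f \<in> edges H \<Longrightarrow> f' \<in> edges H \<Longrightarrow> leaf f = leaf f' \<longleftrightarrow> f = f'"
  using degree_1_unique[OF deg_leaf, of f f f'] edge[of f] edge[of f'] by (metis insertI1)

lemma leaf_verts: "f \<in> edges H \<Longrightarrow> leaf f \<in> verts H" "f \<in> edges H \<Longrightarrow> centre f \<in> verts H"
  using edge[of f] simple_graph_edge_subset[OF simple, of f] by auto

lemma leaf_Nc: "f \<in> edges H \<Longrightarrow> leaf f \<in> Nc \<longleftrightarrow> centre f = c"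
proof
  assume f: "f \<in> edges H" "leaf f \<in> Nc"
  then have "{c, leaf f} \<in> edges H" by (simp add: Nc_def)
  then have "f = {c, leaf f}"
    using degree_1_unique[OF deg_leaf[OF f(1)] f(1), of "{c, leaf f}"] edge[OF f(1)] by auto
  then show "centre f = c" using edge[OF f(1)] leaf_neq_centre[OF f(1) f(1)] by (auto simp: doubleton_eq_iff)
next
  assume "f \<in> edges H" "centre f = c"
  then show "leaf f \<in> Nc" using edge[of f] by (simp add: Nc_def insert_commute)
qed

lemma finite_edges: "finite (edges H)"
  using simple by (rule simple_graph_finite_edges)

lemma card_leaves: "card (leaf ` edges H) = e"
  using leaf_inj by (intro card_image) (auto simp: inj_on_def)

lemma leaf_mem: "y \<in> leaf ` edges H" "w2 \<in> leaf ` edges H" "w1 \<in> leaf ` edges H" "z \<in> leaf ` edges H"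
  using leaves star_edges by (metis imageI)+

lemma \<phi>_range: "a \<in> leaf ` edges H \<Longrightarrow> \<phi> a \<in> {1..e}"
  using bij_\<phi> by (auto simp: bij_betw_def card_leaves)

lemma \<phi>_inj: "a \<in> leaf ` edges H \<Longrightarrow> b \<in> leaf ` edges H \<Longrightarrow> \<phi> a = \<phi> b \<longleftrightarrow> a = b"
  using bij_\<phi> by (auto simp: bij_betw_def inj_on_def)

lemma \<phi>_y': "\<phi> y = e"
  using \<phi>_y by (simp add: card_leaves)

lemma w2_Nc: "w2 \<notin> Nc" "w1 \<in> Nc" "z \<in> Nc" "y \<notin> Nc"
  using leaf_Nc[OF star_edges(2)] leaf_Nc[OF star_edges(3)] leaf_Nc[OF star_edges(4)]
    leaf_Nc[OF star_edges(1)] leaves xc by simp_all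

lemma w_neq: "w1 \<noteq> w2" "w1 \<noteq> y" "z \<noteq> y" "z \<noteq> w2"
  using w2_Nc by auto

lemma \<kappa>_sym: "\<kappa> u v = \<kappa> v u"
  by (cases u; cases v) (auto simp: \<rho>1_def \<rho>2_def w2_Nc)

lemma colour_pair: "colour {u, v} = \<kappa> u v"
proof -
  have "(\<exists>u' v'. {u, v} = {u', v'} \<and> k = \<kappa> u' v') \<longleftrightarrow> k = \<kappa> u v" for k
    using \<kappa>_sym by (metis doubleton_eq_iff)
  then show ?thesis by (simp add: colour_def)
qed

lemma edge_GI: "u \<in> A \<Longrightarrow> v \<in> A \<union> Inr ` {..<N} \<Longrightarrow> u \<noteq> v \<Longrightarrow> {u, v} \<in> edges G"
  by (auto simp: G_def)

lemma edge_GE: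
  assumes "\<epsilon> \<in> edges G"
  obtains u v where "\<epsilon> = {u, v}" "u \<in> A" "v \<in> A \<union> Inr ` {..<N}" "u \<noteq> v"
  using assms by (auto simp: G_def)

lemma G_independent: "{Inr m, Inr m'} \<notin> edges G"
proof
  assume "{Inr m, Inr m'} \<in> edges G"
  then obtain u v where "{Inr m, Inr m'} = {u, v}" "u \<in> A" "v \<in> A \<union> Inr ` {..<N}" "u \<noteq> v"
    by (rule edge_GE)
  then have "u \<in> {Inr m, Inr m'}" by simp
  then show False using \<open>u \<in> A\<close> by (auto simp: A_def)
qed

lemma simple_G: "simple_graph G"
  using finite_edges by (auto simp: simple_graph_def G_def A_def)

lemma e_pos: "e \<ge> 1"
  using \<phi>_range[OF leaf_mem(1)] by simp

lemma colour_range: "\<epsilon> \<in> edges G \<Longrightarrow> colour \<epsilon> \<in> {1..e}"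
proof -
  assume "\<epsilon> \<in> edges G"
  then obtain u v where uv: "\<epsilon> = {u, v}" "u \<in> A" "v \<in> A \<union> Inr ` {..<N}" "u \<noteq> v"
    by (rule edge_GE)
  obtain a where a: "u = Inl a" "a \<in> leaf ` edges H" using uv(2) by (auto simp: A_def)
  have "e \<in> {1..e}" using e_pos by simp
  then have \<rho>: "\<rho>1 b \<in> {1..e}" "\<rho>2 b \<in> {1..e}" if "b \<in> leaf ` edges H" for b
    using \<phi>_range[OF that] by (simp_all add: \<rho>1_def \<rho>2_def)
  show "colour \<epsilon> \<in> {1..e}"
  proof (cases v)
    case (Inl b)
    then have "b \<in> leaf ` edges H" using uv(3) by (auto simp: A_def)
    then show ?thesis
      using \<rho> a \<open>e \<in> {1..e}\<close> by (simp add: uv(1) colour_pair Inl del: atLeastAtMost_iff)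
  next
    case (Inr m)
    then show ?thesis
      using \<phi>_range a by (simp add: uv(1) colour_pair del: atLeastAtMost_iff)
  qed
qed

text \<open>
  Each edge of a copy is charged to its leaf, or to its centre if the leaf lies outside \<open>A\<close>. The edges
  from a vertex of \<open>A\<close> to the complement of \<open>A\<close> all have the same colour, so the charging is injective.
\<close>

lemma G_free: "\<not> has_rainbow_copy H G colour"
proof
  assume "has_rainbow_copy H G colour"
  then obtain h where "rainbow_embedding h H G colour"
    using has_rainbow_copy_iff[OF simple] by blast
  then have h: "inj_on h (verts H)" "\<And>f. f \<in> edges H \<Longrightarrow> h ` f \<in> edges G"
    and col: "inj_on (\<lambda>f. colour (h ` f)) (edges H)"
    by (auto simp: rainbow_embedding_def)
  have hf: "h ` f = {h (leaf f), h (centre f)}" if "f \<in> edges H" for f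
    using arg_cong[OF edge[OF that], of "(`) h"] by simp
  define \<psi> where "\<psi> f = (if h (leaf f) \<in> A then h (leaf f) else h (centre f))" for f
  have outside: "h (centre f) \<in> A \<and> (\<exists>m. h (leaf f) = Inr m)" if f: "f \<in> edges H" "h (leaf f) \<notin> A" for f
  proof -
    obtain u v where "h ` f = {u, v}" "u \<in> A" "v \<in> A \<union> Inr ` {..<N}" "u \<noteq> v"
      using edge_GE[OF h(2)[OF f(1)]] .
    then show ?thesis using f(2) unfolding hf[OF f(1)] by (auto simp: doubleton_eq_iff)
  qed
  have \<psi>_A: "\<psi> ` edges H \<subseteq> A" using outside by (auto simp: \<psi>_def)
  have h_inj: "a = b" if "h a = h b" "a \<in> verts H" "b \<in> verts H" for a b
    using h(1) that by (auto simp: inj_on_def)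
  have "inj_on \<psi> (edges H)"
  proof (rule inj_onI)
    fix f f' assume f: "f \<in> edges H" "f' \<in> edges H" "\<psi> f = \<psi> f'"
    \<comment> \<open>Distinct edges have distinct leaves and no leaf is a centre, so only the last
      case needs the colours.\<close>
    consider "h (leaf f) = h (leaf f')" | "h (leaf f) = h (centre f')" | "h (centre f) = h (leaf f')"
      | "h (leaf f) \<notin> A" "h (leaf f') \<notin> A" "h (centre f) = h (centre f')"
      using f(3) unfolding \<psi>_def by (metis (full_types))
    then show "f = f'"
    proof cases
      case 1
      then show ?thesis using h_inj[OF 1] leaf_verts f leaf_inj by simp
    next
      case 2
      then show ?thesis using h_inj[OF 2] leaf_verts f leaf_neq_centre by simp
    next
      case 3
      then show ?thesis using h_inj[OF 3] leaf_verts f leaf_neq_centre[of f' f] by simp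
    next
      case 4
      obtain a where a: "h (centre f) = Inl a" using outside[OF f(1) 4(1)] by (auto simp: A_def)
      obtain m where m: "h (leaf f) = Inr m" using outside[OF f(1) 4(1)] by blast
      obtain m' where m': "h (leaf f') = Inr m'" using outside[OF f(2) 4(2)] by blast
      have "colour (h ` f) = colour (h ` f')"
        using hf[OF f(1)] hf[OF f(2)] a m m' 4(3) by (simp add: colour_pair)
      then show ?thesis using inj_onD[OF col] f by blast
    qed
  qed
  then have "e \<le> card A"
    using \<psi>_A finite_edges by (intro card_inj_on_le) (auto simp: A_def)
  also have "card A = e - 1"
    using leaf_mem(1) finite_edges card_leaves by (simp add: A_def card_image card_Diff_singleton)
  finally show False using e_pos by simp
qed

text \<open>\<open>f0\<close> goes to the new edge, and the edge with leaf \<open>l\<close> takes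
  over the colour of the leaf \<open>\<tau> l\<close>. As \<open>e\<close> is the number of
  \<open>y\<close>, all colours have this form, and distinctness reduces to injectivity of
  \<open>\<tau>\<close>.\<close>

lemma copyI:
  assumes inj: "inj_on h (verts H)" and range: "h ` verts H \<subseteq> A \<union> Inr ` {..<N}"
    and f0: "f0 \<in> edges H" "h (centre f0) = Inr m" "h (leaf f0) = Inr m'"
    and old: "\<And>f. f \<in> edges H - {f0} \<Longrightarrow> (h (leaf f) \<in> A \<or> h (centre f) \<in> A) \<and>
          \<kappa> (h (leaf f)) (h (centre f)) = \<phi> (\<tau> (leaf f)) \<and>
          \<tau> (leaf f) \<in> leaf ` edges H \<and> \<phi> (\<tau> (leaf f)) \<noteq> i"
    and \<tau>: "inj_on \<tau> (leaf ` edges H - {leaf f0})"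
  shows "has_rainbow_copy H (add_edge {Inr m, Inr m'} G) (colour({Inr m, Inr m'} := i))"
proof -
  have hf: "h ` f = {h (leaf f), h (centre f)}" if "f \<in> edges H" for f
    using arg_cong[OF edge[OF that], of "(`) h"] by simp
  have f0_eq: "{centre f0, leaf f0} = f0" using edge[OF f0(1)] by (simp add: insert_commute)
  have "has_rainbow_copy H (add_edge {h (centre f0), h (leaf f0)} G)
      (colour({h (centre f0), h (leaf f0)} := i))"
  proof (rule rainbow_copy_add_edge[OF simple _ inj, where k = "\<lambda>f. \<phi> (\<tau> (leaf f))"])
    show "{centre f0, leaf f0} \<in> edges H" using f0(1) f0_eq by simp
    show "h ` verts H \<subseteq> verts G" using range by (simp add: G_def)
    show "{h (centre f0), h (leaf f0)} \<notin> edges G"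
      using G_independent by (simp add: f0)
    show "h ` f \<in> edges G \<and> colour (h ` f) = \<phi> (\<tau> (leaf f)) \<and> \<phi> (\<tau> (leaf f)) \<noteq> i"
      if "f \<in> edges H - {{centre f0, leaf f0}}" for f
    proof -
      have f: "f \<in> edges H" "f \<in> edges H - {f0}" using that by (auto simp: f0_eq)
      have neq: "h (leaf f) \<noteq> h (centre f)"
        using inj_onD[OF inj, of "leaf f" "centre f"] leaf_verts f leaf_neq_centre by blast
      have "h (leaf f) \<in> A \<union> Inr ` {..<N}" "h (centre f) \<in> A \<union> Inr ` {..<N}"
        using range leaf_verts f by blast+
      then have "{h (leaf f), h (centre f)} \<in> edges G"
        using old[OF f(2)] edge_GI[of "h (leaf f)" "h (centre f)"] edge_GI[of "h (centre f)" "h (leaf f)"] neq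
        by (auto simp: insert_commute)
      then show ?thesis
        using old[OF f(2)] hf[OF f(1)] colour_pair by simp
    qed
    show "inj_on (\<lambda>f. \<phi> (\<tau> (leaf f))) (edges H - {{centre f0, leaf f0}})"
      unfolding f0_eq
    proof (rule inj_onI)
      fix f f' assume f: "f \<in> edges H - {f0}" "f' \<in> edges H - {f0}" "\<phi> (\<tau> (leaf f)) = \<phi> (\<tau> (leaf f'))"
      then have "\<tau> (leaf f) = \<tau> (leaf f')" using old \<phi>_inj by blast
      then have "leaf f = leaf f'"
        using inj_onD[OF \<tau>, of "leaf f" "leaf f'"] f leaf_inj f0(1) by auto
      then show "f = f'" using leaf_inj f by blast
    qed
  qed
  then show ?thesis by (simp add: f0)
qed

lemma edge_neq_xy: "f \<in> edges H \<Longrightarrow> f \<noteq> {x, y} \<Longrightarrow> leaf f \<noteq> y"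
  using leaf_inj[OF _ star_edges(1)] leaves by auto

lemma G_addable:
  assumes m: "m < N" "m' < N" "m \<noteq> m'" and i: "i \<ge> 1"
  shows "has_rainbow_copy H (add_edge {Inr m, Inr m'} G) (colour({Inr m, Inr m'} := i))"
proof -
  have fin: "finite (verts H)" using simple by (simp add: simple_graph_def)
  have "card ({..<N} - {m, m'}) = N - 2"
    using m by (subst card_Diff_subset) auto
  \<comment> \<open>\<open>\<iota>\<close> supplies outside vertices away from the new edge, mainly
    for the centres.\<close>
  then have "card (verts H) \<le> card ({..<N} - {m, m'})" using N_ge by simp
  then obtain \<iota> where \<iota>: "inj_on \<iota> (verts H)" "\<iota> ` verts H \<subseteq> {..<N} - {m, m'}"
    using card_le_inj[OF fin] by blast
  have \<iota>_N: "\<iota> v < N" "\<iota> v \<noteq> m" "\<iota> v \<noteq> m'" if "v \<in> verts H" for v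
    using \<iota>(2) that by auto
  have \<iota>_inj: "\<iota> u = \<iota> v \<longleftrightarrow> u = v" if "u \<in> verts H" "v \<in> verts H" for u v
    using \<iota>(1) that by (auto simp: inj_on_def)
  have V: "x \<in> verts H" "y \<in> verts H" "c \<in> verts H" "w1 \<in> verts H" "w2 \<in> verts H" "z \<in> verts H"
    using star_edges simple_graph_edge_subset[OF simple] by blast+
  let ?\<Lambda> = "leaf ` edges H"
  have centres: "x \<notin> ?\<Lambda>" "c \<notin> ?\<Lambda>" "\<And>f. f \<in> edges H \<Longrightarrow> centre f \<notin> ?\<Lambda>"
    using deg deg_leaf deg_centre by fastforce+
  consider "i \<ge> e"
    | j where "j \<in> ?\<Lambda>" "j \<noteq> y" "\<phi> j = i" "j \<notin> Nc"
    | j where "j \<in> ?\<Lambda>" "j \<noteq> y" "\<phi> j = i" "j \<in> Nc"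
  proof (cases "i \<ge> e")
    case False
    then have "i \<in> \<phi> ` ?\<Lambda>" using bij_\<phi> i by (auto simp: bij_betw_def card_leaves)
    then obtain j where "j \<in> ?\<Lambda>" "\<phi> j = i" by blast
    moreover have "j \<noteq> y" using \<phi>_y' False \<open>\<phi> j = i\<close> by auto
    ultimately show thesis using that by blast
  qed
  then show ?thesis
  proof cases
    case 1
    \<comment> \<open>The other leaves stay in place with outside centres, so they use only colours
      below \<open>e\<close>.\<close>
    define h :: "'a \<Rightarrow> 'a + nat" where
      "h v = (if v = x then Inr m else if v = y then Inr m' else if v \<in> ?\<Lambda> then Inl v else Inr (\<iota> v))" for v
    show ?thesis
    proof (rule copyI[where h = h and \<tau> = "\<lambda>l. l" and ?f0.0 = "{x, y}"])
      show "inj_on h (verts H)"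
        using m \<iota>_N \<iota>_inj by (auto simp: inj_on_def h_def split: if_splits)
      show "h ` verts H \<subseteq> A \<union> Inr ` {..<N}"
        using m \<iota>_N by (auto simp: h_def A_def)
      show "h (centre {x, y}) = Inr m" "h (leaf {x, y}) = Inr m'"
        using leaves neq by (auto simp: h_def)
      show "(h (leaf f) \<in> A \<or> h (centre f) \<in> A) \<and> \<kappa> (h (leaf f)) (h (centre f)) = \<phi> (leaf f) \<and>
          leaf f \<in> ?\<Lambda> \<and> \<phi> (leaf f) \<noteq> i" if f: "f \<in> edges H - {{x, y}}" for f
      proof -
        have "centre f \<notin> ?\<Lambda>" using f centres by auto
        then have "centre f \<noteq> y" using leaf_mem by auto
        moreover have "leaf f \<in> ?\<Lambda>" "leaf f \<noteq> y" "leaf f \<noteq> x"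
          using f edge_neq_xy centres by auto
        moreover have "\<phi> (leaf f) < e"
          using \<phi>_range[OF \<open>leaf f \<in> ?\<Lambda>\<close>] \<phi>_inj[of "leaf f" y] \<phi>_y' calculation leaf_mem
          by (auto simp: order_less_le)
        ultimately show ?thesis using f 1 centres by (auto simp: h_def A_def)
      qed
    qed (use star_edges in auto)
  next
    case (2 j)
    define h :: "'a \<Rightarrow> 'a + nat" where
      "h v = (if v = x then Inr m else if v = y then Inr m' else if v = c then Inl w1
         else if v = w1 then Inr (\<iota> y) else if v = z then Inl j else if v = j then Inl z
         else if v \<in> ?\<Lambda> then Inl v else Inr (\<iota> v))" for v
    \<comment> \<open>An explicit left inverse of \<open>h\<close> on
      \<open>verts H\<close>.\<close>
    define h' where "h' = case_sum (\<lambda>a. if a = w1 then c else if a = j then z else if a = z then j else a)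
      (\<lambda>n. if n = m then x else if n = m' then y else if n = \<iota> y then w1 else the_inv_into (verts H) \<iota> n)"
    define \<tau> where "\<tau> l = (if l = z then y else if l = j then z else l)" for l
    have jz: "j \<noteq> z" "j \<noteq> w1" using 2 w2_Nc by auto
    show ?thesis
    proof (rule copyI[where h = h and \<tau> = \<tau> and ?f0.0 = "{x, y}"])
      show "inj_on h (verts H)"
      proof (rule inj_on_inverseI[where g = h'])
        fix v assume v: "v \<in> verts H"
        have "v = y" if "\<iota> v = \<iota> y" using \<iota>_inj[OF v V(2)] that by simp
        then show "h' (h v) = v"
          using \<iota>_N[OF v] \<iota>_N[OF V(2)] the_inv_into_f_f[OF \<iota>(1) v] m(3) leaf_mem jz distinct
          unfolding h_def h'_def by (cases "v \<in> ?\<Lambda>") (simp_all, fastforce?)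
      qed
      show "h ` verts H \<subseteq> A \<union> Inr ` {..<N}"
        using m \<iota>_N V 2 leaf_mem w_neq by (auto simp: h_def A_def)
      show "h (centre {x, y}) = Inr m" "h (leaf {x, y}) = Inr m'"
        using leaves neq by (auto simp: h_def)
      show "(h (leaf f) \<in> A \<or> h (centre f) \<in> A) \<and> \<kappa> (h (leaf f)) (h (centre f)) = \<phi> (\<tau> (leaf f)) \<and>
          \<tau> (leaf f) \<in> ?\<Lambda> \<and> \<phi> (\<tau> (leaf f)) \<noteq> i" if f: "f \<in> edges H - {{x, y}}" for f
      proof -
        have l: "leaf f \<in> ?\<Lambda>" "leaf f \<noteq> y" "leaf f \<noteq> x" "leaf f \<noteq> c"
          using f edge_neq_xy centres by auto
        have q: "centre f \<notin> ?\<Lambda>" using f centres by auto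
        then have q': "centre f \<noteq> y" "centre f \<noteq> w1" "centre f \<noteq> z" "centre f \<noteq> j"
          using leaf_mem 2 by auto
        have lNc: "leaf f \<in> Nc \<longleftrightarrow> centre f = c" using leaf_Nc f by simp
        have \<tau>f: "\<tau> (leaf f) \<in> ?\<Lambda>" "\<tau> (leaf f) \<noteq> j"
          using l(1) leaf_mem 2(2) jz(1) by (simp_all add: \<tau>_def)
        then have "\<phi> (\<tau> (leaf f)) \<noteq> i" using \<phi>_inj[OF \<tau>f(1) 2(1)] 2(3) by simp
        moreover have hc: "h (centre f) = (if centre f = c then Inl w1 else if centre f = x then Inr m else Inr (\<iota> (centre f)))"
          using q q' xc by (auto simp: h_def)
        moreover have hl: "h (leaf f) = (if leaf f = w1 then Inr (\<iota> y) else if leaf f = z then Inl j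
            else if leaf f = j then Inl z else Inl (leaf f))"
          using l by (auto simp: h_def)
        moreover have "(h (leaf f) \<in> A \<or> h (centre f) \<in> A) \<and> \<kappa> (h (leaf f)) (h (centre f)) = \<phi> (\<tau> (leaf f))"
        proof -
          have Inl_A: "Inl w1 \<in> A" "Inl z \<in> A" "leaf f \<noteq> y \<Longrightarrow> Inl (leaf f) \<in> A"
            using leaf_mem w_neq l(1) by (simp_all add: A_def)
          show ?thesis
          proof (cases "centre f = c")
            case True
            then have "leaf f \<noteq> j" using lNc 2 by auto
            then show ?thesis
              unfolding hl hc using True lNc Inl_A w2_Nc 2 jz distinct
              by (simp add: \<rho>1_def \<tau>_def \<phi>_y')
          next
            case False
            then have "leaf f \<noteq> w1" "leaf f \<noteq> z" using lNc w2_Nc by auto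
            then show ?thesis
              unfolding hl hc using False Inl_A l(2) by (simp add: \<tau>_def)
          qed
        qed
        ultimately show ?thesis using \<tau>f(1) by simp
      qed
      show "inj_on \<tau> (?\<Lambda> - {leaf {x, y}})"
        using leaves jz by (auto simp: inj_on_def \<tau>_def)
    qed (use star_edges in auto)
  next
    case (3 j)
    \<comment> \<open>Here \<open>{c, j}\<close> goes to the new edge and the star at
      \<open>x\<close> is recentred at \<open>w2\<close>. The leaf \<open>y\<close> takes the place
      of \<open>j\<close>, with colour \<open>e\<close>, which is its own number, so
      \<open>\<tau>\<close> is the identity.\<close>
    define h :: "'a \<Rightarrow> 'a + nat" where
      "h v = (if v = c then Inr m else if v = j then Inr m' else if v = x then Inl w2
         else if v = w2 then Inr (\<iota> y) else if v = y then Inl j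
         else if v \<in> ?\<Lambda> then Inl v else Inr (\<iota> v))" for v
    define h' where "h' = case_sum (\<lambda>a. if a = w2 then x else if a = j then y else a)
      (\<lambda>n. if n = m then c else if n = m' then j else if n = \<iota> y then w2 else the_inv_into (verts H) \<iota> n)"
    have cj: "{c, j} \<in> edges H" using 3 by (simp add: Nc_def)
    have "c \<noteq> j" using 3 centres by auto
    then have lcj: "leaf {c, j} = j" "centre {c, j} = c"
      using leaf_eq cj deg by auto
    have j_neq: "j \<noteq> w2" "j \<noteq> y" using 3 w2_Nc by auto
    show ?thesis
    proof (rule copyI[where h = h and \<tau> = "\<lambda>l. l" and ?f0.0 = "{c, j}"])
      show "inj_on h (verts H)"
      proof (rule inj_on_inverseI[where g = h'])
        fix v assume v: "v \<in> verts H"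
        have "v = y" if "\<iota> v = \<iota> y" using \<iota>_inj[OF v V(2)] that by simp
        then show "h' (h v) = v"
          using \<iota>_N[OF v] \<iota>_N[OF V(2)] the_inv_into_f_f[OF \<iota>(1) v] m(3) leaf_mem j_neq 3(1) distinct
          unfolding h_def h'_def by (cases "v \<in> ?\<Lambda>") (simp_all, fastforce?)
      qed
      show "h ` verts H \<subseteq> A \<union> Inr ` {..<N}"
        using m \<iota>_N V 3 leaf_mem distinct by (auto simp: h_def A_def)
      show "h (centre {c, j}) = Inr m" "h (leaf {c, j}) = Inr m'"
        using lcj \<open>c \<noteq> j\<close> by (auto simp: h_def)
      show "(h (leaf f) \<in> A \<or> h (centre f) \<in> A) \<and> \<kappa> (h (leaf f)) (h (centre f)) = \<phi> (leaf f) \<and>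
          leaf f \<in> ?\<Lambda> \<and> \<phi> (leaf f) \<noteq> i" if f: "f \<in> edges H - {{c, j}}" for f
      proof -
        have l: "leaf f \<in> ?\<Lambda>" "leaf f \<noteq> x" "leaf f \<noteq> c" "leaf f \<noteq> j"
          using f centres leaf_inj[of f "{c, j}"] cj lcj by auto
        have q: "centre f \<notin> ?\<Lambda>" using f centres by auto
        then have q': "centre f \<noteq> y" "centre f \<noteq> w2" "centre f \<noteq> j"
          using leaf_mem 3 by auto
        have lNc: "leaf f \<in> Nc \<longleftrightarrow> centre f = c" using leaf_Nc f by simp
        have lx: "leaf f \<in> {y, w2} \<Longrightarrow> centre f = x"
          using leaf_inj[of f "{x, y}"] leaf_inj[of f "{x, w2}"] f star_edges leaves by auto
        have "\<phi> (leaf f) \<noteq> i" using \<phi>_inj[OF l(1) 3(1)] l(4) 3(3) by simp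
        moreover have hc: "h (centre f) = (if centre f = c then Inr m else if centre f = x then Inl w2 else Inr (\<iota> (centre f)))"
          using q q' xc by (auto simp: h_def)
        moreover have hl: "h (leaf f) = (if leaf f = w2 then Inr (\<iota> y) else if leaf f = y then Inl j
            else Inl (leaf f))"
          using l by (auto simp: h_def)
        moreover have "(h (leaf f) \<in> A \<or> h (centre f) \<in> A) \<and> \<kappa> (h (leaf f)) (h (centre f)) = \<phi> (leaf f)"
        proof -
          have Inl_A: "Inl w2 \<in> A" "leaf f \<noteq> y \<Longrightarrow> Inl (leaf f) \<in> A"
            using leaf_mem distinct(1) l(1) by (simp_all add: A_def)
          show ?thesis
          proof (cases "centre f = x")
            case True
            then have "leaf f \<notin> Nc" using lNc xc by simp
            then have "leaf f \<noteq> w1" using w2_Nc by auto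
            then show ?thesis
              unfolding hl hc using True xc \<open>leaf f \<notin> Nc\<close> Inl_A w2_Nc w_neq 3 j_neq distinct
              by (simp add: \<rho>1_def \<rho>2_def \<phi>_y')
          next
            case False
            then have "leaf f \<noteq> y" "leaf f \<noteq> w2" using lx by auto
            then show ?thesis
              unfolding hl hc using False Inl_A by simp
          qed
        qed
        ultimately show ?thesis using l(1) by simp
      qed
    qed (use cj in auto)
  qed
qed

lemma rainbow_sat_bound:
  assumes t: "t \<ge> e"
  shows "rainbow_sat t (e - 1 + N) H \<le> (e - 1) * (e - 1 + N)"
proof -
  have fin: "finite A"
    using finite_edges by (simp add: A_def)
  have cardA: "card A = e - 1"
    using leaf_mem(1) finite_edges card_leaves by (simp add: A_def card_image card_Diff_singleton)
  have "card (A \<union> Inr ` {..<N}) = card A + card ((Inr :: nat \<Rightarrow> 'a + nat) ` {..<N})"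
    using fin by (intro card_Un_disjoint) (auto simp: A_def)
  then have cardV: "card (verts G) = e - 1 + N"
    by (simp add: G_def card_image cardA)
  have B: "\<exists>m < N. u = Inr m" if "u \<in> verts G - A" for u
    using that by (auto simp: G_def)
  have "rainbow_sat t (card (verts G)) H \<le> card A * card (verts G)"
  proof (rule rainbow_sat_le[OF simple _ G_free])
    show "coloured_graph t G colour"
      using simple_G colour_range t by (fastforce simp: coloured_graph_def)
    show "A \<subseteq> verts G" by (simp add: G_def)
    show "{u, v} \<notin> edges G" if "u \<in> verts G - A" "v \<in> verts G - A" for u v
      using B[OF that(1)] B[OF that(2)] G_independent by blast
    show "has_rainbow_copy H (add_edge {u, v} G) (colour({u, v} := i))"
      if "u \<in> verts G - A" "v \<in> verts G - A" "u \<noteq> v" "i \<in> {1..t}" for u v i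
      using B[OF that(1)] B[OF that(2)] G_addable that by auto
  qed
  then show ?thesis by (simp add: cardV cardA)
qed

end

text \<open>Any other vertex lies on an edge, which must be a spoke at \<open>x\<close>. Applied in
  contrapositive form, this yields an edge avoiding a given centre.\<close>

lemma is_starI:
  assumes H: "simple_graph H" and no_isolated: "\<nexists>v. isolated_vertex H v"
    and x: "x \<in> verts H" "\<And>f. f \<in> edges H \<Longrightarrow> x \<in> f"
  shows "is_star H"
proof -
  let ?S = "verts H - {x}"
  have fin: "finite ?S" using H by (simp add: simple_graph_def)
  obtain b where "bij_betw b {1..card ?S} ?S"
    using ex_bij_betw_nat_finite_1[OF fin] ..
  from bij_betw_inv_into[OF this] obtain b where b: "bij_betw b ?S {1..card ?S}" ..
  define f where "f v = (if v = x then 0 else b v)" for v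
  have f_b: "f v = b v" if "v \<in> ?S" for v using that by (simp add: f_def)
  have bij_S: "bij_betw f ?S {1..card ?S}"
    by (rule bij_betw_cong[THEN iffD2, OF _ b]) (rule f_b)
  have "bij_betw f (?S \<union> {x}) ({1..card ?S} \<union> {0})"
    by (rule bij_betw_combine[OF bij_S]) (auto simp: f_def)
  moreover have "?S \<union> {x} = verts H" "{1..card ?S} \<union> {0} = {0..card ?S}"
    using x(1) by auto
  ultimately have bij: "bij_betw f (verts H) {0..card ?S}" by simp
  have star: "\<exists>v \<in> ?S. g = {x, v}" if g: "g \<in> edges H" for g
  proof -
    obtain v where "g = {x, v}" "x \<noteq> v" "x \<in> verts H" "v \<in> verts H"
      using simple_graph_edge_other[OF H g x(2)[OF g]] .
    then show ?thesis by blast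
  qed
  have spoke: "{x, v} \<in> edges H" if v: "v \<in> ?S" for v
  proof -
    obtain g where g: "g \<in> edges H" "v \<in> g"
      using no_isolated v by (auto simp: isolated_vertex_def)
    then show ?thesis using star[OF g(1)] v by auto
  qed
  have "edges H = (\<lambda>v. {x, v}) ` ?S" using star spoke by blast
  then have "(`) f ` edges H = (\<lambda>i. {0, i}) ` f ` ?S"
    by (auto simp: image_image f_def insert_commute)
  also have "f ` ?S = {1..card ?S}" using bij_S by (simp add: bij_betw_def)
  finally have "(`) f ` edges H = edges (star_graph (card ?S))"
    by (auto simp: star_graph_def)
  then have "isomorphic H (star_graph (card ?S))"
    using bij by (auto simp: isomorphic_def star_graph_def)
  then show ?thesis by (auto simp: is_star_def)
qed

lemma degree_ge_2_obtain:
  assumes "degree H v \<ge> 2"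
  obtains f g where "f \<in> edges H" "g \<in> edges H" "v \<in> f" "v \<in> g" "f \<noteq> g"
proof -
  have card: "\<not> card {f \<in> edges H. v \<in> f} \<le> Suc 0"
    using assms by (simp add: degree_def)
  then have "finite {f \<in> edges H. v \<in> f}"
    by (intro card_ge_0_finite) simp
  with card have "\<not> (\<forall>f \<in> {f \<in> edges H. v \<in> f}. \<forall>g \<in> {f \<in> edges H. v \<in> f}. f = g)"
    by (simp add: card_le_Suc0_iff_eq)
  then show thesis using that by blast
qed

lemma rainbow_sat_star_forest:
  fixes H :: "'a sgraph"
  assumes H: "simple_graph H" and no_isolated: "\<nexists>v. isolated_vertex H v"
    and not_star: "\<not> is_star H" and ne: "edges H \<noteq> {}"
    and leaf: "\<And>f. f \<in> edges H \<Longrightarrow> \<exists>u v. f = {u, v} \<and> degree H u = 1 \<and> degree H v \<ge> 2"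
    and t: "t \<ge> card (edges H)" and N: "N \<ge> card (verts H) + 2"
  shows "rainbow_sat t (card (edges H) - 1 + N) H \<le> (card (edges H) - 1) * (card (edges H) - 1 + N)"
proof -
  obtain lf ct where lc: "\<And>f. f \<in> edges H \<Longrightarrow> f = {lf f, ct f} \<and> degree H (lf f) = 1 \<and> degree H (ct f) \<ge> 2"
    using leaf by metis
  have two: "\<exists>y w. {q, y} \<in> edges H \<and> {q, w} \<in> edges H \<and> y \<noteq> w" if "degree H q \<ge> 2" for q
  proof -
    obtain f g where fg: "f \<in> edges H" "g \<in> edges H" "q \<in> f" "q \<in> g" "f \<noteq> g"
      using degree_ge_2_obtain[OF \<open>degree H q \<ge> 2\<close>] .
    obtain y where y: "f = {q, y}" "q \<noteq> y" "q \<in> verts H" "y \<in> verts H"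
      using simple_graph_edge_other[OF H fg(1,3)] .
    obtain w where w: "g = {q, w}" "q \<noteq> w" "q \<in> verts H" "w \<in> verts H"
      using simple_graph_edge_other[OF H fg(2,4)] .
    show ?thesis using fg y w by blast
  qed
  obtain f0 where f0: "f0 \<in> edges H" using ne by blast
  define x where "x = ct f0"
  have x: "x \<in> verts H" "degree H x \<ge> 2"
    using lc[OF f0] simple_graph_edge_subset[OF H f0] by (auto simp: x_def)
  \<comment> \<open>\<open>H\<close> is not a star, so some edge misses \<open>x\<close>; its centre
    is the second centre \<open>c\<close>.\<close>
  obtain f1 where f1: "f1 \<in> edges H" "x \<notin> f1"
    using is_starI[OF H no_isolated x(1)] not_star by blast
  define c where "c = ct f1"
  have c: "x \<noteq> c" "degree H c \<ge> 2"
    using lc[OF f1(1)] f1(2) unfolding c_def by blast+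
  obtain y w2 where yw: "{x, y} \<in> edges H" "{x, w2} \<in> edges H" "y \<noteq> w2"
    using two[OF x(2)] by blast
  obtain w1 z where wz: "{c, w1} \<in> edges H" "{c, z} \<in> edges H" "w1 \<noteq> z"
    using two[OF c(2)] by blast
  have "lf {x, y} = y"
    using lc[OF yw(1)] x(2) by (auto simp: doubleton_eq_iff)
  then have y: "y \<in> lf ` edges H" using yw(1) by (metis imageI)
  have "finite (lf ` edges H)" using simple_graph_finite_edges[OF H] by simp
  then obtain \<phi> where "bij_betw \<phi> (lf ` edges H) {1..card (lf ` edges H)}"
    "\<phi> y = card (lf ` edges H)"
    by (rule ex_bij_last[OF _ y])
  then interpret star_forest H lf ct x c y z w1 w2 \<phi> N
    using H lc x(2) c yw wz N by unfold_locales simp_all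
  show ?thesis using rainbow_sat_bound[OF t] .
qed

section \<open>Asymptotics\<close>

text \<open>The summand 1 allows for rounding the logarithm up; it is at most \<open>log 2 n\<close>
  from \<open>n = 2\<close> on, hence the factor 2.\<close>

lemma bigo_n_log_nI:
  fixes f :: "nat \<Rightarrow> nat"
  assumes "eventually (\<lambda>n. real (f n) \<le> C * (log 2 (real n) + 1) * real n) sequentially"
  shows "(\<lambda>n. real (f n)) \<in> O(\<lambda>n. real n * log 2 (real n))"
proof (rule bigoI[where c = "2 * \<bar>C\<bar>"])
  show "eventually (\<lambda>n. norm (real (f n)) \<le> 2 * \<bar>C\<bar> * norm (real n * log 2 (real n))) sequentially"
    using assms eventually_ge_at_top[of 2]
  proof eventually_elim
    case (elim n)
    have log: "log 2 (real n) \<ge> 1" using elim by (subst le_log_iff) auto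
    note elim(1)
    also have "C * (log 2 (real n) + 1) * real n \<le> \<bar>C\<bar> * (2 * log 2 (real n)) * real n"
      using log by (intro mult_right_mono mult_mono) auto
    also have "\<dots> = 2 * \<bar>C\<bar> * norm (real n * log 2 (real n))"
      using log by (simp add: abs_mult)
    finally show ?case by simp
  qed
qed

text \<open>Follows from \<open>ln n / n\<close> tending to 0. It ensures that the gadgets fit into
  \<open>n\<close> vertices.\<close>

lemma eventually_log_le:
  "eventually (\<lambda>n. K * (log 2 (real n) + 1) \<le> real n) sequentially" if K: "K \<ge> 0"
proof -
  have "eventually (\<lambda>n. ln (real n) / real n < ln 2 / (2 * (K + 1))) sequentially"
    using K by (intro order_tendstoD(2)[OF filterlim_compose[OF ln_x_over_x_tendsto_0 filterlim_real_sequentially]]) simp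
  moreover have "eventually (\<lambda>n. real n \<ge> 2 * K + 1) sequentially"
    using filterlim_real_sequentially by (simp add: filterlim_at_top)
  ultimately show ?thesis
  proof eventually_elim
    case (elim n)
    have "ln (real n) * (2 * (K + 1)) < ln 2 * real n"
      using elim K by (simp add: field_simps)
    then have "log 2 (real n) * (2 * (K + 1)) < real n"
      by (simp add: log_def field_simps)
    then have "2 * (K * log 2 (real n)) + 2 * log 2 (real n) < real n"
      by (simp add: algebra_simps)
    moreover have "log 2 (real n) \<ge> 0" using elim K by simp
    ultimately have "K * log 2 (real n) + K \<le> real n" using elim K by linarith
    then show ?case by (simp add: distrib_left)
  qed
qed

lemma rainbow_sat_nonpendant:
  fixes H :: "'a sgraph"
  assumes H: "simple_graph H" and no_isolated: "\<nexists>v. isolated_vertex H v"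
    and nonpendant: "{u, v} \<in> edges H" "degree H u \<ge> 2" "degree H v \<ge> 2"
    and t: "t \<ge> card (edges H)"
  shows "(\<lambda>n. real (rainbow_sat t n H)) \<in> O(\<lambda>n. real n * log 2 (real n))"
proof -
  let ?e = "card (edges H)"
  let ?P = "\<lambda>(x, y). {x, y} \<in> edges H \<and> degree H x \<ge> 2 \<and> degree H y \<ge> 2"
  have fin: "finite (edges H)" using H by (rule simple_graph_finite_edges)
  have "degree H x \<le> ?e" for x
    unfolding degree_def using fin by (intro card_mono) auto
  then have "\<forall>p. ?P p \<longrightarrow> (case p of (x, y) \<Rightarrow> degree H x + degree H y) < 2 * ?e + 1"
    by (auto simp: less_Suc_eq_le mult_2 add_mono)
  then obtain x y where xy: "?P (x, y)"
    and max: "\<And>x' y'. ?P (x', y') \<Longrightarrow> degree H x' + degree H y' \<le> degree H x + degree H y"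
    using ex_has_greatest_nat[of ?P "(u, v)" "\<lambda>(x, y). degree H x + degree H y" "2 * ?e + 1"] nonpendant
    by fastforce
  have "x \<noteq> y" using simple_graph_card_edge[OF H, of "{x, y}"] xy by auto
  obtain \<phi> where \<phi>: "bij_betw \<phi> (edges H) {1..?e}" "\<phi> {x, y} = ?e"
    using ex_bij_last[OF fin, of "{x, y}"] xy by auto
  have gadget: "gadget_graph H x y \<phi> L N" if "N \<le> 2 ^ L" for L N
    using H no_isolated xy \<open>x \<noteq> y\<close> max \<phi> that by unfold_locales auto
  define K where "K = ?e * card (verts H - {x, y})"
  have "eventually (\<lambda>n. real (rainbow_sat t n H) \<le> real K * (log 2 (real n) + 1) * real n) sequentially"
    using eventually_log_le[of "real K", OF of_nat_0_le_iff] eventually_ge_at_top[of 1]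
  proof eventually_elim
    case (elim n)
    \<comment> \<open>Enough binary digits for all numbers below \<open>n\<close>, in particular for
      the outside vertices.\<close>
    define L where "L = nat \<lceil>log 2 (real n)\<rceil>"
    have log: "log 2 (real n) \<ge> 0" using elim by simp
    have L: "log 2 (real n) \<le> real L" "real L \<le> log 2 (real n) + 1"
      using log by (simp_all add: L_def)
    have "real n \<le> 2 powr real L" using L(1) elim by (subst (asm) log_le_iff) auto
    then have n: "n \<le> 2 ^ L" by (simp add: powr_realpow flip: of_nat_le_iff)
    define a where "a = K * L"
    have a: "real a \<le> real K * (log 2 (real n) + 1)"
      unfolding a_def of_nat_mult using L(2) by (intro mult_left_mono) auto
    then have "a \<le> n" using elim by linarith
    \<comment> \<open>\<open>a\<close> is the size of \<open>A\<close>, so the graph has exactly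
      \<open>n\<close> vertices.\<close>
    interpret gadget_graph H x y \<phi> L "n - a"
      using n by (intro gadget) simp
    have "card A = a" by (simp add: card_A a_def K_def core_def mult_ac)
    then have "rainbow_sat t n H \<le> a * n"
      using rainbow_sat_bound[OF t] \<open>a \<le> n\<close> by simp
    then have "real (rainbow_sat t n H) \<le> real a * real n"
      by (simp flip: of_nat_mult)
    also have "\<dots> \<le> real K * (log 2 (real n) + 1) * real n"
      using a by (intro mult_right_mono) auto
    finally show ?case .
  qed
  then show ?thesis by (rule bigo_n_log_nI)
qed

lemma bigo_n_log_n_if_linear:
  fixes f :: "nat \<Rightarrow> nat"
  assumes "\<And>N. N \<ge> N0 \<Longrightarrow> f (a + N) \<le> a * (a + N)"
  shows "(\<lambda>n. real (f n)) \<in> O(\<lambda>n. real n * log 2 (real n))"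
proof (rule bigo_n_log_nI)
  show "eventually (\<lambda>n. real (f n) \<le> real a * (log 2 (real n) + 1) * real n) sequentially"
    using eventually_ge_at_top[of "a + N0"] eventually_ge_at_top[of 1]
  proof eventually_elim
    case (elim n)
    have "f n \<le> a * n" using assms[of "n - a"] elim by simp
    then have "real (f n) \<le> real a * 1 * real n" by (simp flip: of_nat_mult)
    also have "\<dots> \<le> real a * (log 2 (real n) + 1) * real n"
      using elim by (intro mult_right_mono mult_left_mono) auto
    finally show ?case .
  qed
qed

theorem theorem1p2:
  fixes H :: "'a sgraph" and t :: nat
  assumes "simple_graph H"
    and "\<nexists>v. isolated_vertex H v"
    and "\<not> is_star H"
    and "t \<ge> card (edges H)"
  shows "(\<lambda>n. real (rainbow_sat t n H)) \<in> O(\<lambda>n. real n * log 2 (real n))"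
proof -
  note H = assms(1)
  have deg_pos: "degree H w \<ge> 1" if "f \<in> edges H" "w \<in> f" for f w
    using degree_pos[OF H that] .
  \<comment> \<open>Without an edge of the nonpendant kind every edge has a leaf; the last two cases
    differ in whether some edge has two.\<close>
  consider (null) "edges H = {}"
    | (nonpendant) u v where "{u, v} \<in> edges H" "degree H u \<ge> 2" "degree H v \<ge> 2"
    | (isolated_edge) u v where "{u, v} \<in> edges H" "degree H u = 1" "degree H v = 1"
        "\<And>f. f \<in> edges H \<Longrightarrow> \<exists>w \<in> f. degree H w = 1"
    | (stars) "edges H \<noteq> {}"
        "\<And>f. f \<in> edges H \<Longrightarrow> \<exists>u v. f = {u, v} \<and> degree H u = 1 \<and> degree H v \<ge> 2"
  proof (cases "\<exists>u v. {u, v} \<in> edges H \<and> degree H u \<ge> 2 \<and> degree H v \<ge> 2")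
    case False
    have leaf: "\<exists>u v. f = {u, v} \<and> degree H u = 1 \<and> degree H v \<ge> 1" if f: "f \<in> edges H" for f
    proof -
      obtain u v where uv: "f = {u, v}" "u \<noteq> v" "u \<in> verts H" "v \<in> verts H"
        using simple_graph_edgeE[OF H f] .
      have "degree H u \<ge> 1" "degree H v \<ge> 1" using deg_pos[OF f] uv(1) by auto
      moreover have "\<not> (degree H u \<ge> 2 \<and> degree H v \<ge> 2)" using False f uv(1) by blast
      ultimately have "degree H u = 1 \<or> degree H v = 1" by linarith
      then show ?thesis
        using uv(1) \<open>degree H u \<ge> 1\<close> \<open>degree H v \<ge> 1\<close> by (metis insert_commute)
    qed
    show thesis
    proof (cases "\<exists>u v. {u, v} \<in> edges H \<and> degree H u = 1 \<and> degree H v = 1")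
      case True
      then obtain u v where "{u, v} \<in> edges H" "degree H u = 1" "degree H v = 1" by blast
      moreover have "\<exists>w \<in> f. degree H w = 1" if "f \<in> edges H" for f
        using leaf[OF that] by blast
      ultimately show thesis by (rule isolated_edge)
    next
      case no_iso: False
      have "\<exists>u v. f = {u, v} \<and> degree H u = 1 \<and> degree H v \<ge> 2" if f: "f \<in> edges H" for f
      proof -
        obtain u v where "f = {u, v}" "degree H u = 1" "degree H v \<ge> 1" using leaf[OF f] by blast
        moreover have "degree H v \<noteq> 1" using no_iso f calculation by blast
        ultimately show ?thesis by (intro exI[of _ u] exI[of _ v]) simp
      qed
      then show thesis using null stars by blast
    qed
  qed (use nonpendant in blast)
  then show ?thesis
  proof cases
    case null
    then have "has_rainbow_copy H G c" for G :: "nat sgraph" and c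
    proof -
      have "verts H = {}" using null assms(2) by (auto simp: isolated_vertex_def)
      then have "rainbow_embedding (\<lambda>_. 0) H G c" using null by (simp add: rainbow_embedding_def)
      then show ?thesis using has_rainbow_copy_iff[OF H] by blast
    qed
    then have "rainbow_sat t n H = Inf {}" for n
      by (simp add: rainbow_sat_def rainbow_saturated_def)
    \<comment> \<open>The value is constant in \<open>n\<close>, and a constant \<open>a\<close> is
      at most \<open>a * (a + N)\<close> once \<open>N \<ge> 1\<close>.\<close>
    then show ?thesis
      by (intro bigo_n_log_n_if_linear[where a = "Inf {}" and ?N0.0 = 1]) simp
  next
    case nonpendant
    then show ?thesis using rainbow_sat_nonpendant[OF H assms(2) _ _ _ assms(4)] by blast
  next
    case (isolated_edge u v)
    have "u \<noteq> v" using simple_graph_card_edge[OF H, of "{u, v}"] isolated_edge by auto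
    show ?thesis
      using rainbow_sat_isolated_edge[OF H assms(2) isolated_edge(1) \<open>u \<noteq> v\<close> isolated_edge(2,3,4) assms(4)]
      by (intro bigo_n_log_n_if_linear[where a = "card (verts H)" and ?N0.0 = 0])
  next
    case stars
    show ?thesis
      using rainbow_sat_star_forest[OF H assms(2,3) stars assms(4)]
      by (intro bigo_n_log_n_if_linear[where a = "card (edges H) - 1" and ?N0.0 = "card (verts H) + 2"])
  qed
qed

end
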